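(* In the setting and notation of the context, let $n\ge3$ and let $h\in\Delta_0$ be neither a sink nor a source in $\Delta$. Then $\mathrm{card}(\mathscr C_h/{\equiv})=1$.
   Context: Conventions: paths are composed from left to right ($pq$ means $p$ followed by $q$, so $t(p)=s(q)$, where $s,t$ denote source and target); $e_h$ is the trivial path at a vertex $h$; an oriented cycle is a path of length $\ge 1$ with equal source and target. Setting. $K$ is an algebraically closed field, $\Delta$ is a finite connected quiver with vertex set $\Delta_0$ and arrow set $\Delta_1$, $R_\Delta\subset K\Delta$ is the ideal generated by the arrows, $n\ge 2$, and $A=K\Delta/R_\Delta^n$. It is assumed that every oriented cycle in $\Delta$ is zero in $A$ and that $\dim_K A>1$. $\overline{p}$ is the class in $A$ of a path $p$. Let $\mathbb M=\{p_1,\dots,p_t\}$ be a set of paths in $\Delta$ whose classes form a basis of $\mathrm{soc}_{A^e}A$ (the socle of $A$ as a bimodule); extend it by paths $p_{t+1},\dots,p_d$ to a basis $\{\overline{p_1},\dots,\overline{p_d}\}$ of $A$ (consisting of the classes of all paths of length $<n$), with dual basis $\{\overline{p_1}^*,\dots,\overline{p_d}^*\}$ of $D(A)=\mathrm{Hom}_K(A,K)$. $D(A)$ is an $A$-bimodule via $(afb)(x)=f(bxa)$. Cocycle. Let $n+1\le s\le 2n-2$ and let $\gamma=x_1x_2\cdots x_s$ be an oriented cycle of length $s$ in $\Delta$; indices of $x_i$ are read modulo $s$. For $1\le i\le s$ let $\alpha_i:A\times A\to D(A)$ be the bilinear map given on paths $a,b$ of $\Delta$ with $\overline a,\overline b\ne0$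 in $A$, with $m$ the length of $ab$, by: $\alpha_i(\overline a,\overline b)=\overline{x_{i+m}\cdots x_{i+s-1}}^*$ if $n\le m<s$ and $ab=x_i\cdots x_{i+m-1}$; $\alpha_i(\overline a,\overline b)=\overline{e_{s(x_i)}}^*$ if $ab=x_i\cdots x_{i+s-1}$; and $0$ otherwise. Fix $0\ne k\in K$ and put $\alpha=k\sum_{i=1}^s\alpha_i$, a Hochschild $2$-cocycle. $T_\alpha(A)$ is the $K$-algebra $A\oplus D(A)$ with multiplication $(a,f)(b,g)=(ab,\,ag+fb+\alpha(a,b))$. Quiver. $\Delta_{T_\alpha(A)}$ is the quiver with vertex set $\Delta_0$ and arrow set $\Delta_1\cup\{y_{p_1},\dots,y_{p_t}\}$, where $y_{p_i}$ is an arrow from $t(p_i)$ to $s(p_i)$ (it is the ordinary quiver of $T_\alpha(A)$). $\Phi:K\Delta_{T_\alpha(A)}\to T_\alpha(A)$ is the surjective $K$-algebra homomorphism with $\Phi(e_h)=(\overline{e_h},0)$ for vertices $h$, $\Phi(a)=(\overline a,0)$ for $a\in\Delta_1$, $\Phi(y_{p_i})=(0,\overline{p_i}^* )$. An element of $K\Delta_{T_\alpha(A)}$ is said to be zero in $T_\alpha(A)$ if its image under $\Phi$ is zero. Equivalence relation. For a vertex $h$, $\mathscr C_h$ is the set of all oriented cycles $C$ in $\Delta_{T_\alpha(A)}$ with $s(C)=t(C)=h$ and $C\neq0$ in $T_\alpha(A)$. For $C,C'\in\mathscr C_h$ write $C\,\mathscr R\,C'$ if there is an arrow $a$ occurring in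 both $C$ and $C'$ with $s(a)=h$ or $t(a)=h$. $\equiv$ is the equivalence relation on $\mathscr C_h$ generated by $\mathscr R$. *)

theory Defs
  imports
    "Graph_Theory.Digraph_Component"
    "Graph_Theory.Arc_Walk"
    "HOL-Algebra.Algebra"
    "HOL-Library.Poly_Mapping"
    "HOL-Library.FuncSet"
    "HOL-Computational_Algebra.Polynomial"
begin

section \<open>Paths in a quiver\<close>

text \<open>A quiver is a \<open>pre_digraph\<close> (loops and parallel arrows allowed).  A path is its source
  together with its list of arrows, read from left to right; \<open>(v, [])\<close> is the trivial path at
  \<open>v\<close>.\<close>

type_synonym ('v, 'a) qpath = "'v \<times> 'a list"

definition qpaths :: "('v, 'a) pre_digraph \<Rightarrow> ('v, 'a) qpath set" where
  "qpaths G = {p. \<exists>v. pre_digraph.awalk G (fst p) (snd p) v}"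

definition psource :: "('v, 'a) qpath \<Rightarrow> 'v" where
  "psource p = fst p"

definition ptarget :: "('v, 'a) pre_digraph \<Rightarrow> ('v, 'a) qpath \<Rightarrow> 'v" where
  "ptarget G p = last (pre_digraph.awalk_verts G (fst p) (snd p))"

definition plength :: "('v, 'a) qpath \<Rightarrow> nat" where
  "plength p = length (snd p)"

text \<open>Only meaningful when the target of \<open>p\<close> is the source of \<open>q\<close>.\<close>

definition pcomp :: "('v, 'a) qpath \<Rightarrow> ('v, 'a) qpath \<Rightarrow> ('v, 'a) qpath" where
  "pcomp p q = (fst p, snd p @ snd q)"

definition arrow_path :: "('v, 'a) pre_digraph \<Rightarrow> 'a \<Rightarrow> ('v, 'a) qpath" where
  "arrow_path G a = (tail G a, [a])"

definition oriented_cycle :: "('v, 'a) pre_digraph \<Rightarrow> ('v, 'a) qpath \<Rightarrow> bool" where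
  "oriented_cycle G p \<longleftrightarrow> p \<in> qpaths G \<and> 1 \<le> plength p \<and> psource p = ptarget G p"

definition is_sink :: "('v, 'a) pre_digraph \<Rightarrow> 'v \<Rightarrow> bool" where
  "is_sink G v \<longleftrightarrow> out_arcs G v = {}"

definition is_source :: "('v, 'a) pre_digraph \<Rightarrow> 'v \<Rightarrow> bool" where
  "is_source G v \<longleftrightarrow> in_arcs G v = {}"


section \<open>The path algebra and its truncations\<close>

text \<open>An algebra over \<open>'k\<close> is represented by a \<open>module\<close> record, i.e. a ring record with an
  additional scalar multiplication.\<close>

definition path_mult ::
  "('v, 'a) pre_digraph \<Rightarrow> (('v, 'a) qpath \<Rightarrow>\<^sub>0 'k::field) \<Rightarrow> (('v, 'a) qpath \<Rightarrow>\<^sub>0 'k)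
    \<Rightarrow> (('v, 'a) qpath \<Rightarrow>\<^sub>0 'k)" where
  "path_mult G f g =
     (\<Sum>p\<in>Poly_Mapping.keys f. \<Sum>q\<in>Poly_Mapping.keys g.
        if ptarget G p = psource q
        then Poly_Mapping.single (pcomp p q)
               (Poly_Mapping.lookup f p * Poly_Mapping.lookup g q)
        else 0)"

definition path_algebra ::
  "('v, 'a) pre_digraph \<Rightarrow> ('k::field, ('v, 'a) qpath \<Rightarrow>\<^sub>0 'k) module" where
  "path_algebra G =
     \<lparr>carrier = {f. Poly_Mapping.keys f \<subseteq> qpaths G},
      monoid.mult = path_mult G,
      monoid.one = (\<Sum>v\<in>verts G. Poly_Mapping.single (v, []) 1),
      ring.zero = 0,
      ring.add = (+),
      module.smult = (\<lambda>c. Poly_Mapping.map ((*) c))\<rparr>"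

definition arrow_ideal :: "('v, 'a) pre_digraph \<Rightarrow> (('v, 'a) qpath \<Rightarrow>\<^sub>0 'k::field) set" where
  "arrow_ideal G =
     Idl\<^bsub>path_algebra G\<^esub> ((\<lambda>a. Poly_Mapping.single (arrow_path G a) 1) ` arcs G)"

primrec ideal_power :: "('b, 'm) ring_scheme \<Rightarrow> 'b set \<Rightarrow> nat \<Rightarrow> 'b set" where
  "ideal_power R I 0 = carrier R"
| "ideal_power R I (Suc m) = ideal_prod R (ideal_power R I m) I"

text \<open>The quotient ring \<open>P Quot I\<close> together with its induced scalar multiplication.\<close>

definition quot_algebra ::
  "('k, 'b, 'm) module_scheme \<Rightarrow> 'b set \<Rightarrow> ('k, 'b set) module" where
  "quot_algebra P I =
     \<lparr>carrier = carrier (P Quot I),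
      monoid.mult = (\<otimes>\<^bsub>P Quot I\<^esub>),
      monoid.one = \<one>\<^bsub>P Quot I\<^esub>,
      ring.zero = \<zero>\<^bsub>P Quot I\<^esub>,
      ring.add = (\<oplus>\<^bsub>P Quot I\<^esub>),
      module.smult = (\<lambda>c B. \<Union>x\<in>B. I +>\<^bsub>P\<^esub> (c \<odot>\<^bsub>P\<^esub> x))\<rparr>"

definition trunc_ideal :: "('v, 'a) pre_digraph \<Rightarrow> nat \<Rightarrow> (('v, 'a) qpath \<Rightarrow>\<^sub>0 'k::field) set" where
  "trunc_ideal G n = ideal_power (path_algebra G) (arrow_ideal G) n"

definition trunc_algebra ::
  "('v, 'a) pre_digraph \<Rightarrow> nat \<Rightarrow> ('k::field, (('v, 'a) qpath \<Rightarrow>\<^sub>0 'k) set) module" where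
  "trunc_algebra G n = quot_algebra (path_algebra G) (trunc_ideal G n)"

definition pclass ::
  "('v, 'a) pre_digraph \<Rightarrow> nat \<Rightarrow> ('v, 'a) qpath \<Rightarrow> (('v, 'a) qpath \<Rightarrow>\<^sub>0 'k::field) set" where
  "pclass G n p = trunc_ideal G n +>\<^bsub>path_algebra G\<^esub> Poly_Mapping.single p 1"

definition short_paths :: "('v, 'a) pre_digraph \<Rightarrow> nat \<Rightarrow> ('v, 'a) qpath set" where
  "short_paths G n = {p \<in> qpaths G. plength p < n}"


section \<open>Bases and the bimodule socle\<close>

text \<open>The copy of the ground field inside a (nonzero) algebra: the linear algebra in
  \<open>HOL-Algebra\<close> is relative to a subfield of the ring.\<close>

definition scalars :: "('k, 'b, 'm) module_scheme \<Rightarrow> 'b set" where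
  "scalars A = range (\<lambda>c. c \<odot>\<^bsub>A\<^esub> \<one>\<^bsub>A\<^esub>)"

definition is_basis :: "('k, 'b, 'm) module_scheme \<Rightarrow> 'b list \<Rightarrow> 'b set \<Rightarrow> bool" where
  "is_basis A us W \<longleftrightarrow>
     ring.independent A (scalars A) us \<and> ring.Span A (scalars A) us = W"

definition algebra_dim :: "('k, 'b, 'm) module_scheme \<Rightarrow> nat" where
  "algebra_dim A = ring.dim A (scalars A) (carrier A)"

text \<open>The sub-bimodules of a unital algebra are its two-sided ideals; the socle is the sum of
  the simple ones.\<close>

definition simple_subbimodule :: "('b, 'm) ring_scheme \<Rightarrow> 'b set \<Rightarrow> bool" where
  "simple_subbimodule A S \<longleftrightarrow>
     ideal S A \<and> S \<noteq> {\<zero>\<^bsub>A\<^esub>} \<and> (\<forall>J. ideal J A \<and> J \<subseteq> S \<longrightarrow> J = {\<zero>\<^bsub>A\<^esub>} \<or> J = S)"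

definition bimodule_socle :: "('b, 'm) ring_scheme \<Rightarrow> 'b set" where
  "bimodule_socle A = Idl\<^bsub>A\<^esub> (\<Union>{S. simple_subbimodule A S})"


section \<open>The dual bimodule\<close>

definition dual :: "('k::field, 'b, 'm) module_scheme \<Rightarrow> ('b \<Rightarrow> 'k) set" where
  "dual A =
     {f \<in> extensional (carrier A).
        (\<forall>x\<in>carrier A. \<forall>y\<in>carrier A. f (x \<oplus>\<^bsub>A\<^esub> y) = f x + f y) \<and>
        (\<forall>c. \<forall>x\<in>carrier A. f (c \<odot>\<^bsub>A\<^esub> x) = c * f x)}"

definition dual_zero :: "('k::field, 'b, 'm) module_scheme \<Rightarrow> 'b \<Rightarrow> 'k" where
  "dual_zero A = (\<lambda>x\<in>carrier A. 0)"

definition dual_add ::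
  "('k::field, 'b, 'm) module_scheme \<Rightarrow> ('b \<Rightarrow> 'k) \<Rightarrow> ('b \<Rightarrow> 'k) \<Rightarrow> 'b \<Rightarrow> 'k" where
  "dual_add A f g = (\<lambda>x\<in>carrier A. f x + g x)"

definition dual_smult ::
  "('k::field, 'b, 'm) module_scheme \<Rightarrow> 'k \<Rightarrow> ('b \<Rightarrow> 'k) \<Rightarrow> 'b \<Rightarrow> 'k" where
  "dual_smult A c f = (\<lambda>x\<in>carrier A. c * f x)"

definition dual_lact ::
  "('k::field, 'b, 'm) module_scheme \<Rightarrow> 'b \<Rightarrow> ('b \<Rightarrow> 'k) \<Rightarrow> 'b \<Rightarrow> 'k" where
  "dual_lact A a f = (\<lambda>x\<in>carrier A. f (x \<otimes>\<^bsub>A\<^esub> a))"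

definition dual_ract ::
  "('k::field, 'b, 'm) module_scheme \<Rightarrow> ('b \<Rightarrow> 'k) \<Rightarrow> 'b \<Rightarrow> 'b \<Rightarrow> 'k" where
  "dual_ract A f b = (\<lambda>x\<in>carrier A. f (b \<otimes>\<^bsub>A\<^esub> x))"

text \<open>The element dual to the class of \<open>p\<close> with respect to the basis of \<open>trunc_algebra G n\<close>
  given by the classes of all paths of length less than \<open>n\<close>.\<close>

definition dual_path ::
  "('v, 'a) pre_digraph \<Rightarrow> nat \<Rightarrow> ('v, 'a) qpath \<Rightarrow> (('v, 'a) qpath \<Rightarrow>\<^sub>0 'k::field) set \<Rightarrow> 'k" where
  "dual_path G n p =
     (THE f. f \<in> dual (trunc_algebra G n) \<and>
        (\<forall>q\<in>short_paths G n. f (pclass G n q) = (if q = p then 1 else 0)))"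


section \<open>Extensions by a 2-cocycle\<close>

text \<open>\<open>A \<oplus> D(A)\<close> with \<open>(a, f) (b, g) = (a b, a g + f b + \<alpha> a b)\<close>.  The unit \<open>(1, 0)\<close> is the
  correct one for a cocycle vanishing whenever one argument is \<open>1\<close>, as is the case below.\<close>

definition cocycle_extension ::
  "('k::field, 'b, 'm) module_scheme \<Rightarrow> ('b \<Rightarrow> 'b \<Rightarrow> 'b \<Rightarrow> 'k) \<Rightarrow> ('k, 'b \<times> ('b \<Rightarrow> 'k)) module"
where
  "cocycle_extension A \<alpha> =
     \<lparr>carrier = carrier A \<times> dual A,
      monoid.mult = (\<lambda>(a, f) (b, g).
        (a \<otimes>\<^bsub>A\<^esub> b, dual_add A (dual_add A (dual_lact A a g) (dual_ract A f b)) (\<alpha> a b))),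
      monoid.one = (\<one>\<^bsub>A\<^esub>, dual_zero A),
      ring.zero = (\<zero>\<^bsub>A\<^esub>, dual_zero A),
      ring.add = (\<lambda>(a, f) (b, g). (a \<oplus>\<^bsub>A\<^esub> b, dual_add A f g)),
      module.smult = (\<lambda>c (a, f). (c \<odot>\<^bsub>A\<^esub> a, dual_smult A c f))\<rparr>"

text \<open>For a closed path with arrow list \<open>xs\<close>, the path of length \<open>m\<close> that starts with the
  arrow of index \<open>i\<close> and runs along the cycle.  Indices start at 0 and are read modulo the
  length of the cycle.\<close>

definition cycle_segment ::
  "('v, 'a) pre_digraph \<Rightarrow> 'a list \<Rightarrow> nat \<Rightarrow> nat \<Rightarrow> ('v, 'a) qpath" where
  "cycle_segment G xs i m =
     (tail G (xs ! (i mod length xs)), map (\<lambda>j. xs ! ((i + j) mod length xs)) [0..<m])"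

definition alpha_on_paths ::
  "('v, 'a) pre_digraph \<Rightarrow> nat \<Rightarrow> 'a list \<Rightarrow> nat \<Rightarrow> ('v, 'a) qpath \<Rightarrow> ('v, 'a) qpath
    \<Rightarrow> (('v, 'a) qpath \<Rightarrow>\<^sub>0 'k::field) set \<Rightarrow> 'k" where
  "alpha_on_paths G n xs i a b =
     (let s = length xs; m = plength (pcomp a b) in
      if ptarget G a = psource b \<and> n \<le> m \<and> m < s \<and> pcomp a b = cycle_segment G xs i m
      then dual_path G n (cycle_segment G xs (i + m) (s - m))
      else if ptarget G a = psource b \<and> pcomp a b = cycle_segment G xs i s
      then dual_path G n (tail G (xs ! (i mod s)), [])
      else dual_zero (trunc_algebra G n))"

text \<open>The bilinear extension; \<open>dual_path G n a x\<close> is the coordinate of \<open>x\<close> at the class of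
  \<open>a\<close>.\<close>

definition alpha_component ::
  "('v, 'a) pre_digraph \<Rightarrow> nat \<Rightarrow> 'a list \<Rightarrow> nat
    \<Rightarrow> (('v, 'a) qpath \<Rightarrow>\<^sub>0 'k::field) set \<Rightarrow> (('v, 'a) qpath \<Rightarrow>\<^sub>0 'k) set
    \<Rightarrow> (('v, 'a) qpath \<Rightarrow>\<^sub>0 'k) set \<Rightarrow> 'k" where
  "alpha_component G n xs i x y =
     (\<lambda>z\<in>carrier (trunc_algebra G n).
        \<Sum>a\<in>short_paths G n. \<Sum>b\<in>short_paths G n.
          dual_path G n a x * dual_path G n b y * alpha_on_paths G n xs i a b z)"

definition alpha_cocycle ::
  "('v, 'a) pre_digraph \<Rightarrow> nat \<Rightarrow> 'a list \<Rightarrow> 'k::field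
    \<Rightarrow> (('v, 'a) qpath \<Rightarrow>\<^sub>0 'k) set \<Rightarrow> (('v, 'a) qpath \<Rightarrow>\<^sub>0 'k) set
    \<Rightarrow> (('v, 'a) qpath \<Rightarrow>\<^sub>0 'k) set \<Rightarrow> 'k" where
  "alpha_cocycle G n xs k x y =
     (\<lambda>z\<in>carrier (trunc_algebra G n). k * (\<Sum>i<length xs. alpha_component G n xs i x y z))"

definition T_alpha ::
  "('v, 'a) pre_digraph \<Rightarrow> nat \<Rightarrow> 'a list \<Rightarrow> 'k::field
    \<Rightarrow> ('k, (('v, 'a) qpath \<Rightarrow>\<^sub>0 'k) set \<times> ((('v, 'a) qpath \<Rightarrow>\<^sub>0 'k) set \<Rightarrow> 'k)) module" where
  "T_alpha G n xs k = cocycle_extension (trunc_algebra G n) (alpha_cocycle G n xs k)"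


section \<open>The quiver of the extension and the cycles at a vertex\<close>

text \<open>\<open>Inl a\<close> is the arrow \<open>a\<close> of \<open>G\<close> and \<open>Inr p\<close> is the new arrow \<open>y\<^sub>p\<close> from the target to
  the source of \<open>p\<close>, for \<open>p\<close> in \<open>M\<close>.\<close>

definition ext_quiver ::
  "('v, 'a) pre_digraph \<Rightarrow> ('v, 'a) qpath set \<Rightarrow> ('v, 'a + ('v, 'a) qpath) pre_digraph" where
  "ext_quiver G M =
     \<lparr>verts = verts G,
      arcs = Inl ` arcs G \<union> Inr ` M,
      tail = case_sum (tail G) (ptarget G),
      head = case_sum (head G) psource\<rparr>"

definition Phi_arrow ::
  "('v, 'a) pre_digraph \<Rightarrow> nat \<Rightarrow> 'a + ('v, 'a) qpath
    \<Rightarrow> (('v, 'a) qpath \<Rightarrow>\<^sub>0 'k::field) set \<times> ((('v, 'a) qpath \<Rightarrow>\<^sub>0 'k) set \<Rightarrow> 'k)" where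
  "Phi_arrow G n e =
     (case e of
        Inl a \<Rightarrow> (pclass G n (arrow_path G a), dual_zero (trunc_algebra G n))
      | Inr p \<Rightarrow> (\<zero>\<^bsub>trunc_algebra G n\<^esub>, dual_path G n p))"

definition Phi_path ::
  "('v, 'a) pre_digraph \<Rightarrow> nat \<Rightarrow> 'a list \<Rightarrow> 'k::field \<Rightarrow> ('v, 'a + ('v, 'a) qpath) qpath
    \<Rightarrow> (('v, 'a) qpath \<Rightarrow>\<^sub>0 'k) set \<times> ((('v, 'a) qpath \<Rightarrow>\<^sub>0 'k) set \<Rightarrow> 'k)" where
  "Phi_path G n xs k p =
     foldl (\<lambda>t e. t \<otimes>\<^bsub>T_alpha G n xs k\<^esub> Phi_arrow G n e)
       (pclass G n (fst p, []), dual_zero (trunc_algebra G n)) (snd p)"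

text \<open>The algebra homomorphism from the path algebra of \<open>ext_quiver\<close>, determined by its values
  on the trivial paths and on the arrows.\<close>

definition Phi ::
  "('v, 'a) pre_digraph \<Rightarrow> nat \<Rightarrow> 'a list \<Rightarrow> 'k::field
    \<Rightarrow> (('v, 'a + ('v, 'a) qpath) qpath \<Rightarrow>\<^sub>0 'k)
    \<Rightarrow> (('v, 'a) qpath \<Rightarrow>\<^sub>0 'k) set \<times> ((('v, 'a) qpath \<Rightarrow>\<^sub>0 'k) set \<Rightarrow> 'k)" where
  "Phi G n xs k f =
     (\<Oplus>\<^bsub>T_alpha G n xs k\<^esub>p\<in>Poly_Mapping.keys f.
        Poly_Mapping.lookup f p \<odot>\<^bsub>T_alpha G n xs k\<^esub> Phi_path G n xs k p)"

definition zero_in_T ::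
  "('v, 'a) pre_digraph \<Rightarrow> nat \<Rightarrow> 'a list \<Rightarrow> 'k::field
    \<Rightarrow> (('v, 'a + ('v, 'a) qpath) qpath \<Rightarrow>\<^sub>0 'k) \<Rightarrow> bool" where
  "zero_in_T G n xs k f \<longleftrightarrow> Phi G n xs k f = \<zero>\<^bsub>T_alpha G n xs k\<^esub>"

definition nonzero_cycles_at ::
  "('v, 'a) pre_digraph \<Rightarrow> nat \<Rightarrow> 'a list \<Rightarrow> 'k::field \<Rightarrow> ('v, 'a) qpath set \<Rightarrow> 'v
    \<Rightarrow> ('v, 'a + ('v, 'a) qpath) qpath set" where
  "nonzero_cycles_at G n xs k M h =
     {C. oriented_cycle (ext_quiver G M) C \<and> psource C = h \<and>
         \<not> zero_in_T G n xs k (Poly_Mapping.single C 1)}"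

definition shares_arrow_at :: "('v, 'e) pre_digraph \<Rightarrow> 'v \<Rightarrow> (('v, 'e) qpath \<times> ('v, 'e) qpath) set"
where
  "shares_arrow_at Q h =
     {(C, C'). \<exists>e. e \<in> set (snd C) \<and> e \<in> set (snd C') \<and> (tail Q e = h \<or> head Q e = h)}"

definition generated_equiv :: "'b set \<Rightarrow> ('b \<times> 'b) set \<Rightarrow> ('b \<times> 'b) set" where
  "generated_equiv S R = \<Inter>{E. equiv S E \<and> R \<inter> (S \<times> S) \<subseteq> E}"

definition cycle_equiv ::
  "('v, 'a) pre_digraph \<Rightarrow> nat \<Rightarrow> 'a list \<Rightarrow> 'k::field \<Rightarrow> ('v, 'a) qpath set \<Rightarrow> 'v
    \<Rightarrow> (('v, 'a + ('v, 'a) qpath) qpath \<times> ('v, 'a + ('v, 'a) qpath) qpath) set" where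
  "cycle_equiv G n xs k M h =
     generated_equiv (nonzero_cycles_at G n xs k M h) (shares_arrow_at (ext_quiver G M) h)"

end

theory Submission
  imports Defs
begin

text \<open>
  A nonzero path of \<open>T\<^sub>\<alpha>(A)\<close> contains at most one new arrow \<open>y\<^sub>p\<close>, because \<open>D(A)\<close> squares to
  zero.  Hence a nonzero cycle at \<open>h\<close> starts or ends with an arrow of the original quiver: the only
  other possibility is a loop \<open>y\<^sub>p\<close> with \<open>p\<close> closed at \<open>h\<close>, so \<open>p = e\<^sub>h\<close>, and \<open>e\<^sub>h\<close> is not in
  the socle since \<open>h\<close> is not a source.  Conversely, for arrows \<open>a\<close> into \<open>h\<close> and \<open>b\<close> out of \<open>h\<close>
  the path \<open>ab\<close> has length \<open>2 < n\<close> and extends to a maximal nonzero path \<open>p = v a b u\<close>.  Its class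
  spans a simple sub-bimodule, so \<open>p\<close> is one of the basis paths of the socle, and the cycle
  \<open>b u y\<^sub>p v a\<close> is nonzero; the cocycle does not contribute to its product.  So any two
  nonzero cycles at \<open>h\<close> are joined through cycles of this form.
\<close>


section \<open>Paths\<close>

text \<open>Two facts about the socle carry the argument. A basis of it by path classes must contain
  every maximal path \<open>p\<close>, because the coordinate functional of \<open>p\<close> kills
  the classes of all other paths and hence their span. And the arrow ideal annihilates the socle,
  whereas an arrow into \<open>h\<close> does not annihilate the trivial path at \<open>h\<close>.

  The obstacle is the cocycle, which could disturb a product. \<open>Phi_path\<close> multiplies
  from left to right. Up to \<open>y_p\<close> the factors form a subpath of \<open>p\<close>, of
  length below \<open>n\<close>, where \<alpha> vanishes; from \<open>y_p\<close> on the component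
  in \<open>A\<close> is zero, and \<alpha> vanishes there too. Only the bimodule action on
  \<open>D(A)\<close> remains, and the resulting functional takes the value
  \<open>p^*(v a b u) = 1\<close> at the trivial path at \<open>h\<close>.

  The equivalence classes are compared with one fixed cycle through an incoming arrow
  \<open>a0\<close> and an outgoing arrow \<open>b0\<close> of \<open>h\<close>: an outgoing arrow
  of another cycle is paired with \<open>a0\<close>, an incoming one with \<open>b0\<close>.\<close>

context wf_digraph
begin

lemma qpaths_iff: "p \<in> qpaths G \<longleftrightarrow> awalk (fst p) (snd p) (ptarget G p)"
  unfolding qpaths_def ptarget_def by (auto elim!: awalkE' intro: awalkI)

lemma qpath_trivial [simp]: "(v, []) \<in> qpaths G \<longleftrightarrow> v \<in> verts G"
  by (auto simp: qpaths_def awalk_Nil_iff)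

lemma psource_in_verts: "p \<in> qpaths G \<Longrightarrow> psource p \<in> verts G"
  by (auto simp: qpaths_iff psource_def)

lemma ptarget_in_verts: "p \<in> qpaths G \<Longrightarrow> ptarget G p \<in> verts G"
  by (auto simp: qpaths_iff)

lemma ptarget_trivial [simp]: "ptarget G (v, []) = v"
  by (simp add: ptarget_def)

lemma qpath_Cons:
  "(v, a # as) \<in> qpaths G \<longleftrightarrow> a \<in> arcs G \<and> tail G a = v \<and> (head G a, as) \<in> qpaths G"
  by (auto simp: qpaths_def awalk_Cons_iff)

lemma ptarget_Cons [simp]: "ptarget G (v, a # as) = ptarget G (head G a, as)"
  by (simp add: ptarget_def)

lemma ptarget_append: "ptarget G (v, as @ bs) = ptarget G (ptarget G (v, as), bs)"
  by (simp add: ptarget_def awlast_append)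

lemma qpath_append:
  "(v, as @ bs) \<in> qpaths G \<longleftrightarrow> (v, as) \<in> qpaths G \<and> (ptarget G (v, as), bs) \<in> qpaths G"
  unfolding qpaths_def ptarget_def by (auto simp: awlast_append)

lemma ptarget_pcomp: "ptarget G p = psource q \<Longrightarrow> ptarget G (pcomp p q) = ptarget G q"
  by (cases q) (simp add: pcomp_def psource_def ptarget_append)

lemma qpath_pcomp:
  "p \<in> qpaths G \<Longrightarrow> q \<in> qpaths G \<Longrightarrow> ptarget G p = psource q \<Longrightarrow> pcomp p q \<in> qpaths G"
  by (cases p, cases q) (simp add: pcomp_def psource_def qpath_append)

lemma arrow_path_qpath: "a \<in> arcs G \<Longrightarrow> arrow_path G a \<in> qpaths G"
  by (simp add: arrow_path_def qpath_Cons)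

lemma ptarget_arrow_path [simp]: "ptarget G (arrow_path G a) = head G a"
  by (simp add: arrow_path_def)

end

lemma psource_pcomp [simp]: "psource (pcomp p q) = psource p"
  by (simp add: pcomp_def psource_def)

lemma plength_pcomp [simp]: "plength (pcomp p q) = plength p + plength q"
  by (simp add: pcomp_def plength_def)

lemma pcomp_assoc: "pcomp (pcomp p q) r = pcomp p (pcomp q r)"
  by (simp add: pcomp_def)

lemma pcomp_trivial_right [simp]: "pcomp p (v, []) = p"
  by (simp add: pcomp_def)

lemma pcomp_trivial_left: "psource p = v \<Longrightarrow> pcomp (v, []) p = p"
  by (cases p) (simp add: pcomp_def psource_def)

lemma plength_arrow_path [simp]: "plength (arrow_path G a) = 1"
  by (simp add: plength_def arrow_path_def)

lemma psource_arrow_path [simp]: "psource (arrow_path G a) = tail G a"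
  by (simp add: psource_def arrow_path_def)


section \<open>The path algebra\<close>

text \<open>Inserting a fresh key amounts to adding a \<open>single\<close>. Bilinear identities
  thereby reduce to single paths.\<close>

lemma poly_mapping_keys_induct [consumes 1, case_names zero single add]:
  fixes f :: "'b \<Rightarrow>\<^sub>0 'c::comm_monoid_add"
  assumes "Poly_Mapping.keys f \<subseteq> S"
    and zero: "P 0"
    and single: "\<And>p c. p \<in> S \<Longrightarrow> P (Poly_Mapping.single p c)"
    and add: "\<And>f g. Poly_Mapping.keys f \<subseteq> S \<Longrightarrow> Poly_Mapping.keys g \<subseteq> S \<Longrightarrow> P f \<Longrightarrow> P g
      \<Longrightarrow> P (f + g)"
  shows "P f"
  using assms(1)
proof (induction f rule: Poly_Mapping.update_induct)
  case const
  show ?case by (rule zero)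
next
  case (update f a b)
  have eq: "Poly_Mapping.update a b f = Poly_Mapping.single a b + f"
    using update.hyps
    by (intro poly_mapping_eqI)
      (auto simp: lookup_update lookup_add lookup_single in_keys_iff when_def)
  have keys: "Poly_Mapping.keys f \<subseteq> S" "a \<in> S"
    using update.prems update.hyps by (auto simp: keys_update)
  show ?case
    unfolding eq using keys update.IH by (intro add single) auto
qed

lemma keys_sum_subset:
  "(\<And>i. i \<in> I \<Longrightarrow> Poly_Mapping.keys (f i) \<subseteq> S) \<Longrightarrow> Poly_Mapping.keys (sum f I) \<subseteq> S"
  by (induction I rule: infinite_finite_induct) (auto dest!: subsetD[OF Poly_Mapping.keys_add])

lemma keys_scale_subset:
  fixes f :: "'b \<Rightarrow>\<^sub>0 'c::semiring_0"
  shows "Poly_Mapping.keys (Poly_Mapping.map ((*) c) f) \<subseteq> Poly_Mapping.keys f"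
  by (auto simp: in_keys_iff Poly_Mapping.map.rep_eq when_def)

lemma lookup_scale [simp]:
  fixes f :: "'b \<Rightarrow>\<^sub>0 'c::semiring_0"
  shows "Poly_Mapping.lookup (Poly_Mapping.map ((*) c) f) p = c * Poly_Mapping.lookup f p"
  by (auto simp: Poly_Mapping.map.rep_eq when_def)

text \<open>\<open>path_mult\<close> sums over supports, which may shrink by cancellation in a sum.
  Over a common finite superset, additivity can be checked term by term.\<close>

lemma path_mult_superset:
  assumes "finite S" "Poly_Mapping.keys f \<subseteq> S" "finite T" "Poly_Mapping.keys g \<subseteq> T"
  shows "path_mult G f g = (\<Sum>p\<in>S. \<Sum>q\<in>T.
    if ptarget G p = psource q
    then Poly_Mapping.single (pcomp p q) (Poly_Mapping.lookup f p * Poly_Mapping.lookup g q)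
    else 0)"
proof -
  have "path_mult G f g = (\<Sum>p\<in>Poly_Mapping.keys f. \<Sum>q\<in>T.
    if ptarget G p = psource q
    then Poly_Mapping.single (pcomp p q) (Poly_Mapping.lookup f p * Poly_Mapping.lookup g q)
    else 0)"
    unfolding path_mult_def
    by (intro sum.cong sum.mono_neutral_left refl assms) (auto simp: in_keys_iff)
  also have "\<dots> = (\<Sum>p\<in>S. \<Sum>q\<in>T.
    if ptarget G p = psource q
    then Poly_Mapping.single (pcomp p q) (Poly_Mapping.lookup f p * Poly_Mapping.lookup g q)
    else 0)"
    by (intro sum.mono_neutral_left assms) (auto simp: in_keys_iff intro!: sum.neutral)
  finally show ?thesis .
qed

lemma path_mult_add_left: "path_mult G (f + f') g = path_mult G f g + path_mult G f' g"
proof -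
  let ?S = "Poly_Mapping.keys f \<union> Poly_Mapping.keys f'"
  have *: "path_mult G x g = (\<Sum>p\<in>?S. \<Sum>q\<in>Poly_Mapping.keys g.
    if ptarget G p = psource q
    then Poly_Mapping.single (pcomp p q) (Poly_Mapping.lookup x p * Poly_Mapping.lookup g q)
    else 0)" if "Poly_Mapping.keys x \<subseteq> ?S" for x
    using that by (intro path_mult_superset) auto
  have "path_mult G (f + f') g = (\<Sum>p\<in>?S. \<Sum>q\<in>Poly_Mapping.keys g.
    (if ptarget G p = psource q
     then Poly_Mapping.single (pcomp p q) (Poly_Mapping.lookup f p * Poly_Mapping.lookup g q)
     else 0) +
    (if ptarget G p = psource q
     then Poly_Mapping.single (pcomp p q) (Poly_Mapping.lookup f' p * Poly_Mapping.lookup g q)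
     else 0))"
    unfolding *[OF Poly_Mapping.keys_add]
    by (intro sum.cong refl) (simp add: lookup_add distrib_right single_add)
  then show ?thesis
    by (simp add: *[of f] *[of f'] sum.distrib)
qed

lemma path_mult_add_right: "path_mult G f (g + g') = path_mult G f g + path_mult G f g'"
proof -
  let ?S = "Poly_Mapping.keys g \<union> Poly_Mapping.keys g'"
  have *: "path_mult G f x = (\<Sum>p\<in>Poly_Mapping.keys f. \<Sum>q\<in>?S.
    if ptarget G p = psource q
    then Poly_Mapping.single (pcomp p q) (Poly_Mapping.lookup f p * Poly_Mapping.lookup x q)
    else 0)" if "Poly_Mapping.keys x \<subseteq> ?S" for x
    using that by (intro path_mult_superset) auto
  have "path_mult G f (g + g') = (\<Sum>p\<in>Poly_Mapping.keys f. \<Sum>q\<in>?S.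
    (if ptarget G p = psource q
     then Poly_Mapping.single (pcomp p q) (Poly_Mapping.lookup f p * Poly_Mapping.lookup g q)
     else 0) +
    (if ptarget G p = psource q
     then Poly_Mapping.single (pcomp p q) (Poly_Mapping.lookup f p * Poly_Mapping.lookup g' q)
     else 0))"
    unfolding *[OF Poly_Mapping.keys_add]
    by (intro sum.cong refl) (simp add: lookup_add distrib_left single_add)
  then show ?thesis
    by (simp add: *[of g] *[of g'] sum.distrib)
qed

lemma path_mult_0_left [simp]: "path_mult G 0 g = 0"
  by (simp add: path_mult_def)

lemma path_mult_0_right [simp]: "path_mult G f 0 = 0"
  by (simp add: path_mult_def)

lemma path_mult_single [simp]:
  "path_mult G (Poly_Mapping.single p c) (Poly_Mapping.single q d) =
    (if ptarget G p = psource q then Poly_Mapping.single (pcomp p q) (c * d) else 0)"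
  using path_mult_superset[of "{p}" "Poly_Mapping.single p c" "{q}" "Poly_Mapping.single q d" G]
  by simp

lemma path_mult_sum_left: "path_mult G (sum f I) g = (\<Sum>i\<in>I. path_mult G (f i) g)"
  by (induction I rule: infinite_finite_induct) (auto simp: path_mult_add_left)

lemma path_mult_sum_right: "path_mult G f (sum g I) = (\<Sum>i\<in>I. path_mult G f (g i))"
  by (induction I rule: infinite_finite_induct) (auto simp: path_mult_add_right)

text \<open>This is the \<open>m\<close>-th power of the arrow ideal (\<open>trunc_ideal_eq\<close>
  below), and for \<open>m = 0\<close> the whole path algebra.\<close>

definition path_span :: "('v, 'a) pre_digraph \<Rightarrow> nat \<Rightarrow> (('v, 'a) qpath \<Rightarrow>\<^sub>0 'k::field) set" where
  "path_span G m = {f. Poly_Mapping.keys f \<subseteq> {p \<in> qpaths G. m \<le> plength p}}"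

lemma path_span_zero [simp]: "0 \<in> path_span G m"
  by (simp add: path_span_def)

lemma path_span_add: "f \<in> path_span G m \<Longrightarrow> g \<in> path_span G m \<Longrightarrow> f + g \<in> path_span G m"
  unfolding path_span_def using Poly_Mapping.keys_add[of f g] by auto

lemma path_span_uminus: "f \<in> path_span G m \<Longrightarrow> - f \<in> path_span G m"
  by (auto simp: path_span_def in_keys_iff)

lemma path_span_single:
  "p \<in> qpaths G \<Longrightarrow> m \<le> plength p \<Longrightarrow> Poly_Mapping.single p c \<in> path_span G m"
  by (auto simp: path_span_def)

lemma path_span_scale: "f \<in> path_span G m \<Longrightarrow> Poly_Mapping.map ((*) c) f \<in> path_span G m"
  unfolding path_span_def using keys_scale_subset[of c f] by auto

lemma path_span_mono: "l \<le> m \<Longrightarrow> path_span G m \<subseteq> path_span G l"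
  by (auto simp: path_span_def)

lemma path_span_induct [consumes 1, case_names zero single add]:
  assumes "f \<in> path_span G m"
    and "P 0"
    and "\<And>p c. p \<in> qpaths G \<Longrightarrow> m \<le> plength p \<Longrightarrow> P (Poly_Mapping.single p c)"
    and "\<And>f g. f \<in> path_span G m \<Longrightarrow> g \<in> path_span G m \<Longrightarrow> P f \<Longrightarrow> P g \<Longrightarrow> P (f + g)"
  shows "P f"
  using assms(1)[unfolded path_span_def mem_Collect_eq]
  by (induction rule: poly_mapping_keys_induct) (auto intro: assms(2-) simp: path_span_def)

lemma path_algebra_simps [simp]:
  "carrier (path_algebra G) = path_span G 0"
  "monoid.mult (path_algebra G) = path_mult G"
  "ring.zero (path_algebra G) = 0"
  "ring.add (path_algebra G) = (+)"
  "module.smult (path_algebra G) = (\<lambda>c. Poly_Mapping.map ((*) c))"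
  "monoid.one (path_algebra G) = (\<Sum>v\<in>verts G. Poly_Mapping.single (v, []) 1)"
  by (simp_all add: path_algebra_def path_span_def)

context wf_digraph
begin

lemma path_mult_path_span:
  assumes "f \<in> path_span G l" "g \<in> path_span G m"
  shows "path_mult G f g \<in> path_span G (l + m)"
  using assms(1)
proof (induction f rule: path_span_induct)
  case (single p c)
  from assms(2) show ?case
    by (induction g rule: path_span_induct)
      (use single in \<open>auto simp: path_mult_add_right intro!: path_span_add path_span_single qpath_pcomp\<close>)
qed (auto simp: path_mult_add_left intro: path_span_add)

lemma path_mult_assoc:
  assumes "f \<in> path_span G 0" "g \<in> path_span G 0" "e \<in> path_span G 0"
  shows "path_mult G (path_mult G f g) e = path_mult G f (path_mult G g e)"
  using assms(1)
proof (induction f rule: path_span_induct)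
  case (single p c)
  from assms(2) show ?case
  proof (induction g rule: path_span_induct)
    case (single q d)
    from assms(3) show ?case
      by (induction e rule: path_span_induct)
        (auto simp: path_mult_add_right ptarget_pcomp pcomp_assoc mult.assoc)
  qed (auto simp: path_mult_add_left path_mult_add_right)
qed (auto simp: path_mult_add_left)

end

context fin_digraph
begin

text \<open>Of the sum over all trivial paths only the one at the source of the given path survives;
  the sum is meaningful because \<open>verts G\<close> is finite.\<close>

lemma path_mult_one_left:
  assumes "f \<in> path_span G 0"
  shows "path_mult G (\<Sum>v\<in>verts G. Poly_Mapping.single (v, []) 1) f = f"
  using assms
proof (induction f rule: path_span_induct)
  case (single p c)
  have "(\<Sum>v\<in>verts G. path_mult G (Poly_Mapping.single (v, []) 1) (Poly_Mapping.single p c))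
    = (\<Sum>v\<in>verts G. if v = psource p then Poly_Mapping.single p c else 0)"
    by (intro sum.cong) (auto simp: pcomp_trivial_left)
  then show ?case
    using psource_in_verts[OF single(1)] by (simp add: path_mult_sum_left)
qed (auto simp: path_mult_add_right)

lemma path_mult_one_right:
  assumes "f \<in> path_span G 0"
  shows "path_mult G f (\<Sum>v\<in>verts G. Poly_Mapping.single (v, []) 1) = f"
  using assms
proof (induction f rule: path_span_induct)
  case (single p c)
  have "(\<Sum>v\<in>verts G. path_mult G (Poly_Mapping.single p c) (Poly_Mapping.single (v, []) 1))
    = (\<Sum>v\<in>verts G. if ptarget G p = v then Poly_Mapping.single p c else 0)"
    by (intro sum.cong) (auto simp: psource_def)
  then show ?case
    using ptarget_in_verts[OF single(1)] by (simp add: path_mult_sum_right)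
qed (auto simp: path_mult_add_left)

lemma path_one_in_carrier: "(\<Sum>v\<in>verts G. Poly_Mapping.single (v, []) 1) \<in> path_span G 0"
  unfolding path_span_def by (auto intro!: keys_sum_subset)

lemma ring_path_algebra: "ring (path_algebra G :: ('k::field, _) module)"
proof (rule ringI)
  show "abelian_group (path_algebra G :: ('k::field, _) module)"
  proof (rule abelian_groupI)
    fix x assume "x \<in> carrier (path_algebra G :: ('k::field, _) module)"
    then show "\<exists>y\<in>carrier (path_algebra G). y \<oplus>\<^bsub>path_algebra G\<^esub> x = \<zero>\<^bsub>path_algebra G\<^esub>"
      by (intro bexI[of _ "- x"]) (auto intro: path_span_uminus)
  qed (auto simp: add_ac intro: path_span_add)
  show "monoid (path_algebra G :: ('k::field, _) module)"
    using path_mult_path_span[of _ 0 _ 0]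
    by (intro monoidI)
      (auto simp: path_mult_assoc path_mult_one_left path_mult_one_right path_one_in_carrier)
qed (auto simp: path_mult_add_left path_mult_add_right)

section \<open>Powers of the arrow ideal\<close>

lemma ideal_path_span: "ideal (path_span G m :: (_ \<Rightarrow>\<^sub>0 'k::field) set) (path_algebra G)"
proof (rule idealI[OF ring_path_algebra])
  interpret ring "path_algebra G :: ('k, _) module" by (rule ring_path_algebra)
  show "subgroup (path_span G m :: (_ \<Rightarrow>\<^sub>0 'k::field) set) (add_monoid (path_algebra G))"
  proof (rule add.subgroupI)
    fix a :: "('a, 'b) qpath \<Rightarrow>\<^sub>0 'k" assume a: "a \<in> path_span G m"
    then have "a \<in> carrier (path_algebra G)" "- a \<in> carrier (path_algebra G)"
      using path_span_mono[of 0 m G] path_span_uminus[OF a] by auto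
    then have "\<ominus>\<^bsub>path_algebra G\<^esub> a = - a"
      by (intro minus_equality) auto
    then show "\<ominus>\<^bsub>path_algebra G\<^esub> a \<in> path_span G m" by (simp add: path_span_uminus a)
  next
    show "path_span G m \<noteq> {}" using path_span_zero by blast
  qed (use path_span_mono[of 0 m G] in \<open>auto intro: path_span_add\<close>)
next
  fix a x :: "('a, 'b) qpath \<Rightarrow>\<^sub>0 'k"
  assume "a \<in> path_span G m" "x \<in> carrier (path_algebra G)"
  then show "x \<otimes>\<^bsub>path_algebra G\<^esub> a \<in> path_span G m" "a \<otimes>\<^bsub>path_algebra G\<^esub> x \<in> path_span G m"
    using path_mult_path_span[of x 0 a m] path_mult_path_span[of a m x 0] by auto
qed

text \<open>Lengths add under composition; conversely, a path of length at least
  \<open>Suc m\<close> is a path of length at least \<open>m\<close> followed by its last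
  arrow.\<close>

lemma ideal_prod_path_span:
  "ideal_prod (path_algebra G) (path_span G m) (path_span G 1) =
    (path_span G (Suc m) :: (_ \<Rightarrow>\<^sub>0 'k::field) set)"
proof (intro equalityI subsetI)
  fix x :: "_ \<Rightarrow>\<^sub>0 'k"
  assume "x \<in> ideal_prod (path_algebra G) (path_span G m) (path_span G 1)"
  then show "x \<in> path_span G (Suc m)"
    by (induction rule: ideal_prod.induct)
      (use path_mult_path_span[of _ m _ 1] in \<open>auto intro: path_span_add\<close>)
next
  fix x :: "('a, 'b) qpath \<Rightarrow>\<^sub>0 'k"
  assume "x \<in> path_span G (Suc m)"
  then show "x \<in> ideal_prod (path_algebra G) (path_span G m) (path_span G 1)"
  proof (induction rule: path_span_induct)
    case zero
    then show ?case
      using ideal_prod.prod[of 0 "path_span G m" 0 "path_span G 1" "path_algebra G"] by simp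
  next
    case (single p c)
    obtain v as a where p: "p = (v, as @ [a])"
      using single(2) by (cases p; cases "snd p" rule: rev_cases) (auto simp: plength_def)
    then have q: "(v, as) \<in> qpaths G" "a \<in> arcs G" "tail G a = ptarget G (v, as)"
      using single(1) by (auto simp: qpath_append qpath_Cons)
    have "Poly_Mapping.single p c =
      Poly_Mapping.single (v, as) c \<otimes>\<^bsub>path_algebra G\<^esub> Poly_Mapping.single (arrow_path G a) 1"
      using q p by (simp add: pcomp_def arrow_path_def psource_def)
    also have "\<dots> \<in> ideal_prod (path_algebra G) (path_span G m) (path_span G 1)"
      using q p single(2)
      by (intro ideal_prod.prod path_span_single arrow_path_qpath)
        (auto simp: plength_def arrow_path_def)
    finally show ?case .
  next
    case (add f g)
    then show ?case using ideal_prod.sum[of f "path_algebra G"] by simp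
  qed
qed

text \<open>Splitting off the first arrow puts each nontrivial path into the generated ideal; the
  other inclusion is minimality of that ideal.\<close>

lemma arrow_ideal_eq: "arrow_ideal G = (path_span G 1 :: (_ \<Rightarrow>\<^sub>0 'k::field) set)"
proof -
  let ?P = "path_algebra G :: ('k, _) module"
  interpret P: ring ?P by (rule ring_path_algebra)
  let ?X = "(\<lambda>a. Poly_Mapping.single (arrow_path G a) 1) ` arcs G :: (_ \<Rightarrow>\<^sub>0 'k) set"
  have X: "?X \<subseteq> path_span G 1"
    by (auto intro: path_span_single arrow_path_qpath)
  then have "?X \<subseteq> carrier ?P"
    using path_span_mono[of 0 1 G] by auto
  then interpret I: ideal "Idl\<^bsub>?P\<^esub> ?X" ?P
    by (rule P.genideal_ideal)
  have "f \<in> Idl\<^bsub>?P\<^esub> ?X" if "f \<in> path_span G 1" for f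
    using that
  proof (induction rule: path_span_induct)
    case zero
    then show ?case using I.zero_closed by simp
  next
    case (single p c)
    obtain v a as where p: "p = (v, a # as)"
      using single(2) by (cases p) (auto simp: plength_def Suc_le_length_iff)
    then have q: "(head G a, as) \<in> qpaths G" "a \<in> arcs G"
      using single(1) by (auto simp: qpath_Cons)
    have "Poly_Mapping.single p c =
      Poly_Mapping.single (arrow_path G a) 1 \<otimes>\<^bsub>?P\<^esub> Poly_Mapping.single (head G a, as) c"
      using q p single(1) by (simp add: pcomp_def arrow_path_def psource_def qpath_Cons)
    also have "\<dots> \<in> Idl\<^bsub>?P\<^esub> ?X"
      using q P.genideal_self[OF \<open>?X \<subseteq> carrier ?P\<close>]
      by (intro I.I_r_closed) (auto intro: path_span_single)
    finally show ?case .
  next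
    case (add f g)
    then show ?case using I.a_closed by simp
  qed
  then show ?thesis
    unfolding arrow_ideal_def using P.genideal_minimal[OF ideal_path_span X] by blast
qed

text \<open>The zeroth ideal power is the carrier, which is \<open>path_span G 0\<close>, so the
  exponents agree without a shift.\<close>

lemma trunc_ideal_eq: "trunc_ideal G n = (path_span G n :: (_ \<Rightarrow>\<^sub>0 'k::field) set)"
proof -
  have "ideal_power (path_algebra G) (path_span G 1) n = (path_span G n :: (_ \<Rightarrow>\<^sub>0 'k) set)"
    by (induction n) (simp_all add: ideal_prod_path_span[unfolded One_nat_def])
  then show ?thesis
    by (simp add: trunc_ideal_def arrow_ideal_eq)
qed

end


section \<open>The truncated path algebra\<close>

lemma scale_add:
  fixes f :: "'b \<Rightarrow>\<^sub>0 'c::semiring_0"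
  shows "Poly_Mapping.map ((*) c) (f + g) =
    Poly_Mapping.map ((*) c) f + Poly_Mapping.map ((*) c) g"
  by (rule poly_mapping_eqI) (simp add: lookup_add distrib_left)

lemma scale_zero [simp]:
  "Poly_Mapping.map ((*) c) 0 = (0 :: 'b \<Rightarrow>\<^sub>0 'c::semiring_0)"
  by (rule poly_mapping_eqI) simp

lemma path_mult_scale_left:
  "path_mult G (Poly_Mapping.map ((*) c) f) g = Poly_Mapping.map ((*) c) (path_mult G f g)"
proof -
  have f: "Poly_Mapping.keys f \<subseteq> UNIV" and g: "Poly_Mapping.keys g \<subseteq> UNIV" by auto
  from f show ?thesis
  proof (induction f rule: poly_mapping_keys_induct)
    case (single p d)
    from g show ?case
      by (induction g rule: poly_mapping_keys_induct)
        (auto simp: path_mult_add_right scale_add mult.assoc)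
  qed (auto simp: path_mult_add_left scale_add)
qed

lemma path_mult_scale_right:
  fixes f :: "_ \<Rightarrow>\<^sub>0 'k::field"
  shows "path_mult G f (Poly_Mapping.map ((*) c) g) = Poly_Mapping.map ((*) c) (path_mult G f g)"
proof -
  have f: "Poly_Mapping.keys f \<subseteq> UNIV" and g: "Poly_Mapping.keys g \<subseteq> UNIV" by auto
  from f show ?thesis
  proof (induction f rule: poly_mapping_keys_induct)
    case (single p d)
    from g show ?case
      by (induction g rule: poly_mapping_keys_induct)
        (auto simp: path_mult_add_right scale_add mult.left_commute)
  qed (auto simp: path_mult_add_left scale_add)
qed

text \<open>Additive inverses come from multiplication by the negative of the unit.\<close>

lemma (in ring) idealI_closed:
  assumes "I \<subseteq> carrier R" and "\<zero> \<in> I"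
    and "\<And>a b. a \<in> I \<Longrightarrow> b \<in> I \<Longrightarrow> a \<oplus> b \<in> I"
    and left: "\<And>a x. a \<in> I \<Longrightarrow> x \<in> carrier R \<Longrightarrow> x \<otimes> a \<in> I"
    and "\<And>a x. a \<in> I \<Longrightarrow> x \<in> carrier R \<Longrightarrow> a \<otimes> x \<in> I"
  shows "ideal I R"
proof (rule idealI[OF ring_axioms])
  show "subgroup I (add_monoid R)"
  proof (rule add.subgroupI)
    fix a assume "a \<in> I"
    then show "\<ominus> a \<in> I"
      using left[of a "\<ominus> \<one>"] assms(1) by (auto simp: l_minus)
  qed (use assms in auto)
qed (use assms in auto)

lemma (in ideal) ex_nonzero:
  assumes "I \<noteq> {\<zero>}"
  shows "\<exists>x\<in>I. x \<noteq> \<zero>"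
proof (rule ccontr)
  assume "\<not> ?thesis"
  then have "I \<subseteq> {\<zero>}" by blast
  moreover have "{\<zero>} \<subseteq> I" using additive_subgroup.zero_closed[OF is_additive_subgroup] by simp
  ultimately show False using assms by (meson subset_antisym)
qed

text \<open>Extends \<open>pclass\<close> from paths to all representatives, so that the operations
  of \<open>trunc_algebra\<close> can be computed on representatives.\<close>

definition tclass ::
  "('v, 'a) pre_digraph \<Rightarrow> nat \<Rightarrow> (('v, 'a) qpath \<Rightarrow>\<^sub>0 'k::field) \<Rightarrow> (('v, 'a) qpath \<Rightarrow>\<^sub>0 'k) set" where
  "tclass G n f = trunc_ideal G n +>\<^bsub>path_algebra G\<^esub> f"

lemma pclass_eq: "pclass G n p = tclass G n (Poly_Mapping.single p 1)"
  by (simp add: pclass_def tclass_def)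

context fin_digraph
begin

lemma tclass_eq: "tclass G n f = {g. g - f \<in> path_span G n}"
proof -
  have "tclass G n f = (\<Union>h\<in>path_span G n. {h + f})"
    unfolding tclass_def a_r_coset_def' trunc_ideal_eq by simp
  also have "\<dots> = {g. g - f \<in> path_span G n}"
  proof (intro equalityI subsetI)
    fix g assume "g \<in> {g. g - f \<in> path_span G n}"
    then show "g \<in> (\<Union>h\<in>path_span G n. {h + f})"
      by (auto intro!: bexI[of _ "g - f"])
  qed auto
  finally show ?thesis .
qed

lemma tclass_eq_iff: "tclass G n f = tclass G n g \<longleftrightarrow> f - g \<in> path_span G n"
proof
  assume "tclass G n f = tclass G n g"
  moreover have "f \<in> tclass G n f" by (simp add: tclass_eq)
  ultimately show "f - g \<in> path_span G n" by (simp add: tclass_eq)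
next
  assume *: "f - g \<in> path_span G n"
  have "x - g = (x - f) + (f - g)" "x - f = (x - g) + - (f - g)" for x by simp_all
  then have "x - f \<in> path_span G n \<longleftrightarrow> x - g \<in> path_span G n" for x
    using path_span_add[OF _ *] path_span_add[OF _ path_span_uminus[OF *]] by metis
  then show "tclass G n f = tclass G n g" by (simp add: tclass_eq)
qed

lemma tclass_eq_zero_iff: "tclass G n f = tclass G n 0 \<longleftrightarrow> f \<in> path_span G n"
  by (simp add: tclass_eq_iff)

lemma carrier_trunc_algebra:
  "carrier (trunc_algebra G n) = tclass G n ` (path_span G 0 :: (_ \<Rightarrow>\<^sub>0 'k::field) set)"
  by (auto simp: trunc_algebra_def quot_algebra_def FactRing_def A_RCOSETS_def' tclass_def)

lemma tclass_in_carrier [intro]: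
  "f \<in> path_span G 0 \<Longrightarrow> tclass G n f \<in> carrier (trunc_algebra G n)"
  by (simp add: carrier_trunc_algebra)

lemma pclass_in_carrier [intro]:
  "p \<in> qpaths G \<Longrightarrow> pclass G n p \<in> carrier (trunc_algebra G n)"
  by (auto simp: pclass_eq path_span_single)

lemma zero_trunc_algebra: "\<zero>\<^bsub>trunc_algebra G n\<^esub> = tclass G n 0"
  by (simp add: trunc_algebra_def quot_algebra_def FactRing_def trunc_ideal_eq tclass_eq)

lemma one_trunc_algebra:
  "\<one>\<^bsub>trunc_algebra G n\<^esub> = tclass G n (\<Sum>v\<in>verts G. Poly_Mapping.single (v, []) 1)"
  by (simp add: trunc_algebra_def quot_algebra_def FactRing_def tclass_def)

lemma mult_tclass:
  assumes "f \<in> path_span G 0" "g \<in> path_span G 0"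
  shows "tclass G n f \<otimes>\<^bsub>trunc_algebra G n\<^esub> tclass G n g = tclass G n (path_mult G f g)"
  using ideal.rcoset_mult_add[OF ideal_path_span, of f g n] assms
  by (simp add: trunc_algebra_def quot_algebra_def FactRing_def tclass_def trunc_ideal_eq)

lemma add_tclass:
  assumes "f \<in> path_span G 0" "g \<in> path_span G 0"
  shows "tclass G n f \<oplus>\<^bsub>trunc_algebra G n\<^esub> tclass G n g = tclass G n (f + g)"
  using ideal.a_rcos_sum[OF ideal_path_span, of f g n] assms
  by (simp add: trunc_algebra_def quot_algebra_def FactRing_def tclass_def trunc_ideal_eq)

text \<open>Scalar multiplication in the quotient is a union over all representatives; since
  \<open>path_span G n\<close> is closed under scaling, they all contribute the same coset.\<close>

lemma smult_tclass:
  "c \<odot>\<^bsub>trunc_algebra G n\<^esub> tclass G n f = tclass G n (Poly_Mapping.map ((*) c) f)"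
proof -
  have scale_diff: "Poly_Mapping.map ((*) c) g - Poly_Mapping.map ((*) c) f =
    Poly_Mapping.map ((*) c) (g - f)" for g
    by (rule poly_mapping_eqI) (simp add: lookup_minus right_diff_distrib)
  have "c \<odot>\<^bsub>trunc_algebra G n\<^esub> tclass G n f =
    (\<Union>g\<in>tclass G n f. tclass G n (Poly_Mapping.map ((*) c) g))"
    by (simp add: trunc_algebra_def quot_algebra_def tclass_def)
  also have "\<dots> = (\<Union>g\<in>tclass G n f. tclass G n (Poly_Mapping.map ((*) c) f))"
    by (intro SUP_cong refl, subst tclass_eq_iff)
      (auto simp: tclass_eq scale_diff intro: path_span_scale)
  also have "\<dots> = tclass G n (Poly_Mapping.map ((*) c) f)"
    using path_span_zero by (subst UN_constant) (auto simp: tclass_eq[of n f] dest: spec[of _ f])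
  finally show ?thesis .
qed

lemma smult_one:
  fixes x :: "(_ \<Rightarrow>\<^sub>0 'k::field) set"
  assumes "x \<in> carrier (trunc_algebra G n)"
  shows "1 \<odot>\<^bsub>trunc_algebra G n\<^esub> x = x"
proof -
  have "Poly_Mapping.map ((*) 1) f = f" for f :: "('a, 'b) qpath \<Rightarrow>\<^sub>0 'k"
    by (auto intro!: poly_mapping_eqI)
  then show ?thesis
    using assms by (auto simp: carrier_trunc_algebra smult_tclass)
qed

text \<open>The record copies its ring operations from the factor ring, so the axioms transfer field
  by field.\<close>

lemma ring_trunc_algebra: "ring (trunc_algebra G n :: ('k::field, _) module)"
proof -
  let ?P = "path_algebra G :: ('k, _) module"
  let ?Q = "?P Quot trunc_ideal G n"
  interpret Q: ring ?Q
    using ideal.quotient_is_ring[OF ideal_path_span] by (simp add: trunc_ideal_eq)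
  have eqs: "carrier (trunc_algebra G n) = carrier ?Q" "monoid.mult (trunc_algebra G n) = (\<otimes>\<^bsub>?Q\<^esub>)"
    "\<one>\<^bsub>trunc_algebra G n\<^esub> = \<one>\<^bsub>?Q\<^esub>" "\<zero>\<^bsub>trunc_algebra G n\<^esub> = \<zero>\<^bsub>?Q\<^esub>"
    "ring.add (trunc_algebra G n) = (\<oplus>\<^bsub>?Q\<^esub>)"
    by (simp_all add: trunc_algebra_def quot_algebra_def)
  show ?thesis
  proof (rule ringI)
    show "abelian_group (trunc_algebra G n :: ('k::field, _) module)"
      by (rule abelian_groupI) (auto simp: eqs Q.a_ac intro: Q.l_neg)
    show "monoid (trunc_algebra G n :: ('k::field, _) module)"
      by (rule monoidI) (auto simp: eqs Q.m_assoc)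
  qed (auto simp: eqs Q.l_distr Q.r_distr)
qed

section \<open>Coordinates and dual basis functionals\<close>

lemma lookup_eqI_tclass:
  assumes "tclass G n f = tclass G n g" "p \<in> short_paths G n"
  shows "Poly_Mapping.lookup f p = Poly_Mapping.lookup g p"
proof -
  have "p \<notin> Poly_Mapping.keys (f - g)"
    using assms by (auto simp: tclass_eq_iff path_span_def short_paths_def)
  then show ?thesis by (simp add: in_keys_iff lookup_minus)
qed

lemma dual_zero_value: "f \<in> dual (trunc_algebra G n) \<Longrightarrow> f (tclass G n 0) = 0"
proof -
  assume "f \<in> dual (trunc_algebra G n)"
  then have "f (tclass G n 0 \<oplus>\<^bsub>trunc_algebra G n\<^esub> tclass G n 0) =
    f (tclass G n 0) + f (tclass G n 0)"
    unfolding dual_def using tclass_in_carrier[OF path_span_zero] by blast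
  moreover have "tclass G n 0 \<oplus>\<^bsub>trunc_algebra G n\<^esub> tclass G n 0 = tclass G n 0"
    by (simp add: add_tclass)
  ultimately show ?thesis by (metis add_cancel_left_right)
qed

text \<open>Classes of paths of length at least \<open>n\<close> are zero, so the short paths span.
  This gives the uniqueness required by the description \<open>dual_path\<close>.\<close>

lemma dual_eqI:
  fixes f g :: "_ \<Rightarrow> 'k::field"
  assumes "f \<in> dual (trunc_algebra G n)" "g \<in> dual (trunc_algebra G n)"
    and eq: "\<And>q. q \<in> short_paths G n \<Longrightarrow> f (pclass G n q) = g (pclass G n q)"
  shows "f = g"
proof
  have add: "u (tclass G n (x + y)) = u (tclass G n x) + u (tclass G n y)"
    if "u \<in> dual (trunc_algebra G n)" "x \<in> path_span G 0" "y \<in> path_span G 0"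
    for u :: "_ \<Rightarrow> 'k" and x y
    using that unfolding dual_def by (auto simp flip: add_tclass)
  have smult: "u (tclass G n (Poly_Mapping.single p c)) = c * u (pclass G n p)"
    if "u \<in> dual (trunc_algebra G n)" "p \<in> qpaths G" for u :: "_ \<Rightarrow> 'k" and p c
  proof -
    have "tclass G n (Poly_Mapping.single p c) = c \<odot>\<^bsub>trunc_algebra G n\<^esub> pclass G n p"
      by (simp add: pclass_eq smult_tclass)
    moreover have "(pclass G n p :: (_ \<Rightarrow>\<^sub>0 'k) set) \<in> carrier (trunc_algebra G n)"
      using that(2) by (rule pclass_in_carrier)
    ultimately show ?thesis
      using that unfolding dual_def by simp
  qed
  fix x
  show "f x = g x"
  proof (cases "x \<in> carrier (trunc_algebra G n)")
    case True
    then obtain e where e: "e \<in> path_span G 0" and x: "x = tclass G n e"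
      by (auto simp: carrier_trunc_algebra)
    from e have "f (tclass G n e) = g (tclass G n e)"
    proof (induction e rule: path_span_induct)
      case (single p c)
      show ?case
      proof (cases "plength p < n")
        case True
        then show ?thesis
          using assms single by (simp add: smult short_paths_def)
      next
        case False
        then have "tclass G n (Poly_Mapping.single p c) = tclass G n 0"
          using single by (simp add: tclass_eq_zero_iff path_span_single)
        then show ?thesis using assms by (simp add: dual_zero_value)
      qed
    qed (use assms in \<open>auto simp: dual_zero_value add\<close>)
    then show ?thesis by (simp add: x)
  next
    case False
    then show ?thesis using assms unfolding dual_def by (auto simp: extensional_def)
  qed
qed

lemma
  fixes n :: nat and p :: "('a, 'b) qpath"
  shows dual_path_in_dual: "(dual_path G n p :: _ \<Rightarrow> 'k::field) \<in> dual (trunc_algebra G n)"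
    and dual_path_tclass: "\<And>f :: _ \<Rightarrow>\<^sub>0 'k. f \<in> path_span G 0 \<Longrightarrow>
      dual_path G n p (tclass G n f) = (if p \<in> short_paths G n then Poly_Mapping.lookup f p else 0)"
proof -
  \<comment> \<open>The witness reads off the coefficient at \<open>p\<close> of a chosen
    representative. The choice is harmless, since two representatives differ only at long paths. If
    \<open>p\<close> itself is long, the description asks for a functional vanishing on all short
    paths, hence the default 0.\<close>
  define u :: "_ \<Rightarrow> 'k" where "u = (\<lambda>x\<in>carrier (trunc_algebra G n).
    if p \<in> short_paths G n
    then Poly_Mapping.lookup (SOME f. f \<in> path_span G 0 \<and> tclass G n f = x) p else 0)"
  have u: "u (tclass G n f) = (if p \<in> short_paths G n then Poly_Mapping.lookup f p else 0)"
    if "f \<in> path_span G 0" for f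
  proof -
    have *: "tclass G n (SOME g. g \<in> path_span G 0 \<and> tclass G n g = tclass G n f) = tclass G n f"
      using someI[of "\<lambda>g. g \<in> path_span G 0 \<and> tclass G n g = tclass G n f" f] that by auto
    then show ?thesis
      using that lookup_eqI_tclass[OF *, of p] by (auto simp: u_def)
  qed
  have "u \<in> extensional (carrier (trunc_algebra G n))" by (simp add: u_def)
  then have dual: "u \<in> dual (trunc_algebra G n)"
    unfolding dual_def
    by (auto simp: carrier_trunc_algebra add_tclass smult_tclass u path_span_add path_span_scale
        lookup_add)
  have char: "u (pclass G n q) = (if q = p then 1 else 0)" if "q \<in> short_paths G n" for q
    using that by (auto simp: pclass_eq u path_span_single short_paths_def lookup_single)
  have "dual_path G n p = u"
    unfolding dual_path_def
    using dual char by (intro the_equality) (auto intro: dual_eqI)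
  then show "(dual_path G n p :: _ \<Rightarrow> 'k) \<in> dual (trunc_algebra G n)"
    and "\<And>f :: _ \<Rightarrow>\<^sub>0 'k. f \<in> path_span G 0 \<Longrightarrow>
      dual_path G n p (tclass G n f) = (if p \<in> short_paths G n then Poly_Mapping.lookup f p else 0)"
    using dual u by simp_all
qed


section \<open>The bimodule socle\<close>

text \<open>Such a path is nonzero in the truncated algebra, but every extension by an arrow at
  either end is zero or does not exist.\<close>

definition maximal_path :: "nat \<Rightarrow> ('a, 'b) qpath \<Rightarrow> bool" where
  "maximal_path n p \<longleftrightarrow> p \<in> short_paths G n \<and>
    (Suc (plength p) = n \<or> is_source G (psource p) \<and> is_sink G (ptarget G p))"

text \<open>The last arrow of \<open>q\<close> enters the start of \<open>p\<close>, so that vertex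
  is no source and \<open>p\<close> must have length \<open>n - 1\<close>.\<close>

lemma maximal_path_left:
  assumes "maximal_path n p" "q \<in> qpaths G" "plength q \<noteq> 0" "ptarget G q = psource p"
  shows "n \<le> plength (pcomp q p)"
proof -
  obtain v as a where q: "q = (v, as @ [a])"
    using assms(3) by (cases q; cases "snd q" rule: rev_cases) (auto simp: plength_def)
  then have "a \<in> in_arcs G (psource p)"
    using assms(2,4) by (auto simp: qpath_append qpath_Cons ptarget_append)
  then show ?thesis
    using assms(1,3) by (auto simp: maximal_path_def is_source_def)
qed

lemma maximal_path_right:
  assumes "maximal_path n p" "q \<in> qpaths G" "plength q \<noteq> 0" "ptarget G p = psource q"
  shows "n \<le> plength (pcomp p q)"
proof -
  obtain v as a where q: "q = (v, a # as)"
    using assms(3) by (cases q; cases "snd q") (auto simp: plength_def)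
  then have "a \<in> out_arcs G (ptarget G p)"
    using assms(2,4) by (auto simp: qpath_Cons psource_def)
  then show ?thesis
    using assms(1,3) by (auto simp: maximal_path_def is_sink_def)
qed

text \<open>Every nontrivial path in \<open>f\<close> lengthens \<open>p\<close> into the truncation
  ideal, so \<open>f\<close> acts through its coefficient at the trivial path at the source of
  \<open>p\<close>.\<close>

lemma mult_maximal_path_left:
  fixes f :: "_ \<Rightarrow>\<^sub>0 'k::field"
  assumes p: "maximal_path n p" and f: "f \<in> path_span G 0"
  shows "tclass G n f \<otimes>\<^bsub>trunc_algebra G n\<^esub> tclass G n (Poly_Mapping.single p c) =
    tclass G n (Poly_Mapping.single p (Poly_Mapping.lookup f (psource p, []) * c))"
proof -
  have pq: "p \<in> qpaths G" using p by (simp add: maximal_path_def short_paths_def)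
  have "path_mult G f (Poly_Mapping.single p c) -
    Poly_Mapping.single p (Poly_Mapping.lookup f (psource p, []) * c) \<in> path_span G n"
    using f
  proof (induction f rule: path_span_induct)
    case (single q d)
    show ?case
    proof (cases "plength q = 0")
      case True
      then obtain v where q: "q = (v, [])" by (cases q) (auto simp: plength_def)
      then show ?thesis by (auto simp: lookup_single pcomp_trivial_left)
    next
      case False
      then have "q \<noteq> (psource p, [])" by (auto simp: plength_def)
      then show ?thesis
        using maximal_path_left[OF p single(1) False] single(1) pq
        by (auto simp: lookup_single when_def path_span_single qpath_pcomp
            simp del: plength_pcomp)
    qed
  next
    case (add f g)
    then show ?case
      using path_span_add[OF add.IH]
      by (simp add: path_mult_add_left lookup_add distrib_right single_add algebra_simps)
  qed simp
  then show ?thesis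
    using f pq by (simp add: mult_tclass path_span_single tclass_eq_iff)
qed

lemma mult_maximal_path_right:
  fixes f :: "_ \<Rightarrow>\<^sub>0 'k::field"
  assumes p: "maximal_path n p" and f: "f \<in> path_span G 0"
  shows "tclass G n (Poly_Mapping.single p c) \<otimes>\<^bsub>trunc_algebra G n\<^esub> tclass G n f =
    tclass G n (Poly_Mapping.single p (c * Poly_Mapping.lookup f (ptarget G p, [])))"
proof -
  have pq: "p \<in> qpaths G" using p by (simp add: maximal_path_def short_paths_def)
  have "path_mult G (Poly_Mapping.single p c) f -
    Poly_Mapping.single p (c * Poly_Mapping.lookup f (ptarget G p, [])) \<in> path_span G n"
    using f
  proof (induction f rule: path_span_induct)
    case (single q d)
    show ?case
    proof (cases "plength q = 0")
      case True
      then obtain v where q: "q = (v, [])" by (cases q) (auto simp: plength_def)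
      then show ?thesis by (auto simp: lookup_single psource_def)
    next
      case False
      then have "q \<noteq> (ptarget G p, [])" by (auto simp: plength_def)
      then show ?thesis
        using maximal_path_right[OF p single(1) False] single(1) pq
        by (auto simp: lookup_single when_def path_span_single qpath_pcomp
            simp del: plength_pcomp)
    qed
  next
    case (add f g)
    then show ?case
      using path_span_add[OF add.IH]
      by (simp add: path_mult_add_right lookup_add distrib_left single_add algebra_simps)
  qed simp
  then show ?thesis
    using f pq by (simp add: mult_tclass path_span_single tclass_eq_iff)
qed

text \<open>By the two preceding products the line through the class of \<open>p\<close> is a
  sub-bimodule; being one-dimensional, it is simple.\<close>

lemma maximal_path_in_socle:
  assumes p: "maximal_path n p"
  shows "pclass G n p \<in> bimodule_socle (trunc_algebra G n :: ('k::field, _) module)"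
proof -
  let ?A = "trunc_algebra G n :: ('k, _) module"
  interpret A: ring ?A by (rule ring_trunc_algebra)
  have ps: "p \<in> short_paths G n" and pq: "p \<in> qpaths G"
    using p by (auto simp: maximal_path_def short_paths_def)
  let ?t = "\<lambda>c :: 'k. tclass G n (Poly_Mapping.single p c)"
  have t0: "?t 0 = \<zero>\<^bsub>?A\<^esub>" by (simp add: zero_trunc_algebra)
  have t1: "?t 1 \<noteq> \<zero>\<^bsub>?A\<^esub>"
    using lookup_eqI_tclass[OF _ ps, of "Poly_Mapping.single p 1" "0 :: _ \<Rightarrow>\<^sub>0 'k"]
    by (auto simp: zero_trunc_algebra)
  have ideal: "ideal (range ?t) ?A"
  proof (rule A.idealI_closed)
    show "range ?t \<subseteq> carrier ?A"
      using pq by (auto simp: path_span_single)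
    show "\<zero>\<^bsub>?A\<^esub> \<in> range ?t"
      unfolding t0[symmetric] by blast
  next
    fix a b assume "a \<in> range ?t" "b \<in> range ?t"
    then show "a \<oplus>\<^bsub>?A\<^esub> b \<in> range ?t"
      using pq by (auto simp: add_tclass path_span_single simp flip: single_add)
  next
    fix a x assume "a \<in> range ?t" "x \<in> carrier ?A"
    then show "x \<otimes>\<^bsub>?A\<^esub> a \<in> range ?t" "a \<otimes>\<^bsub>?A\<^esub> x \<in> range ?t"
      by (auto simp: carrier_trunc_algebra mult_maximal_path_left[OF p]
          mult_maximal_path_right[OF p])
  qed
  have "simple_subbimodule ?A (range ?t)"
    unfolding simple_subbimodule_def
  proof (intro conjI allI impI ideal)
    show "range ?t \<noteq> {\<zero>\<^bsub>?A\<^esub>}" using t1 by blast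
    fix J assume J: "ideal J ?A \<and> J \<subseteq> range ?t"
    then interpret J: ideal J ?A by blast
    show "J = {\<zero>\<^bsub>?A\<^esub>} \<or> J = range ?t"
    proof (cases "J = {\<zero>\<^bsub>?A\<^esub>}")
      case False
      from J.ex_nonzero[OF False] obtain x where x: "x \<in> J" "x \<noteq> \<zero>\<^bsub>?A\<^esub>"
        by (elim bexE)
      then have "x \<in> range ?t" using J by (auto simp only: subset_iff)
      then obtain c where c: "x = ?t c" by (rule rangeE)
      then have "c \<noteq> 0" using x(2) t0 by (intro notI) simp
      have "?t d \<in> J" for d
      proof -
        \<comment> \<open>This multiple of the trivial path at the source of \<open>p\<close> turns
          \<open>c\<close> times \<open>p\<close> into \<open>d\<close> times
          \<open>p\<close>.\<close>
        let ?e = "Poly_Mapping.single (psource p, []) (d / c) :: _ \<Rightarrow>\<^sub>0 'k"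
        have e: "?e \<in> path_span G 0"
          using psource_in_verts[OF pq] by (simp add: path_span_single)
        then have "tclass G n ?e \<otimes>\<^bsub>?A\<^esub> ?t c \<in> J"
          using x(1) unfolding c by (intro J.I_l_closed) auto
        then show ?thesis
          using \<open>c \<noteq> 0\<close> by (simp add: mult_maximal_path_left[OF p e])
      qed
      then show ?thesis using J by blast
    qed simp
  qed
  moreover have "?t 1 \<in> range ?t" by blast
  ultimately show ?thesis
    unfolding bimodule_socle_def genideal_def pclass_eq by blast
qed

text \<open>The elements killed from the left by the arrow ideal form an ideal \<open>N\<close>. It
  meets every simple sub-bimodule nontrivially because the arrow ideal is nilpotent in the quotient,
  so it contains all of them and with them the socle.\<close>

lemma socle_annihilated:
  assumes x: "x \<in> bimodule_socle (trunc_algebra G n :: ('k::field, _) module)"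
    and f: "f \<in> path_span G 1"
  shows "tclass G n f \<otimes>\<^bsub>trunc_algebra G n\<^esub> x = \<zero>\<^bsub>trunc_algebra G n\<^esub>"
proof -
  let ?A = "trunc_algebra G n :: ('k, _) module"
  interpret A: ring ?A by (rule ring_trunc_algebra)
  define N where "N = {x \<in> carrier ?A. \<forall>f\<in>path_span G 1. tclass G n f \<otimes>\<^bsub>?A\<^esub> x = \<zero>\<^bsub>?A\<^esub>}"
  have span1: "f \<in> path_span G 0" if "f \<in> path_span G 1" for f :: "_ \<Rightarrow>\<^sub>0 'k"
    using that path_span_mono[of 0 1 G] by auto
  have N: "ideal N ?A"
  proof (rule A.idealI_closed)
    fix a x assume a: "a \<in> N" and x: "x \<in> carrier ?A"
    then obtain g where g: "g \<in> path_span G 0" "x = tclass G n g"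
      by (auto simp: carrier_trunc_algebra)
    \<comment> \<open>The product of \<open>f\<close> with a representative of \<open>x\<close>
      stays in the arrow ideal, so it still kills \<open>a\<close>.\<close>
    have "tclass G n f \<otimes>\<^bsub>?A\<^esub> (x \<otimes>\<^bsub>?A\<^esub> a) = \<zero>\<^bsub>?A\<^esub>" if "f \<in> path_span G 1" for f
    proof -
      have "tclass G n f \<otimes>\<^bsub>?A\<^esub> (x \<otimes>\<^bsub>?A\<^esub> a) = tclass G n (path_mult G f g) \<otimes>\<^bsub>?A\<^esub> a"
        using a x g span1[OF that] by (subst A.m_assoc[symmetric]) (auto simp: N_def mult_tclass)
      then show ?thesis
        using a path_mult_path_span[OF that g(1)] by (simp add: N_def)
    qed
    then show "x \<otimes>\<^bsub>?A\<^esub> a \<in> N" using a x by (simp add: N_def)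
    have "tclass G n f \<otimes>\<^bsub>?A\<^esub> (a \<otimes>\<^bsub>?A\<^esub> x) = \<zero>\<^bsub>?A\<^esub>" if "f \<in> path_span G 1" for f
      using a x that span1[OF that] by (subst A.m_assoc[symmetric]) (auto simp: N_def)
    then show "a \<otimes>\<^bsub>?A\<^esub> x \<in> N" using a x by (simp add: N_def)
  qed (auto simp: N_def A.r_distr span1 tclass_in_carrier)
  have "S \<subseteq> N" if S: "simple_subbimodule ?A S" for S
  proof -
    interpret S: ideal S ?A using S by (simp add: simple_subbimodule_def)
    \<comment> \<open>\<open>Q m\<close> says that \<open>S\<close> has a nonzero element in the
      \<open>m\<close>-th power of the arrow ideal. Such \<open>m\<close> are at most
      \<open>n\<close>, and for the greatest one the arrow ideal must kill the element: otherwise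
      the product would be a nonzero element of \<open>S\<close> one power deeper.\<close>
    define Q where "Q m \<longleftrightarrow> (\<exists>f\<in>path_span G m. tclass G n f \<in> S \<and> tclass G n f \<noteq> \<zero>\<^bsub>?A\<^esub>)" for m
    have S0: "S \<noteq> {\<zero>\<^bsub>?A\<^esub>}"
      using S by (simp add: simple_subbimodule_def)
    from S.ex_nonzero[OF S0] obtain x where x: "x \<in> S" "x \<noteq> \<zero>\<^bsub>?A\<^esub>"
      by (elim bexE)
    then obtain f where "f \<in> path_span G 0" "x = tclass G n f"
      using S.a_subset unfolding carrier_trunc_algebra by auto
    then have "Q 0"
      using x unfolding Q_def by auto
    moreover have bound: "m \<le> n" if "Q m" for m
    proof (rule ccontr)
      assume "\<not> m \<le> n"
      then show False
        using that path_span_mono[of n m G]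
        by (auto simp: Q_def zero_trunc_algebra tclass_eq_zero_iff)
    qed
    ultimately have "Q (Greatest Q)" and greatest: "\<And>m. Q m \<Longrightarrow> m \<le> Greatest Q"
      using GreatestI_ex_nat[of Q n] Greatest_le_nat[of Q _ n] by blast+
    then obtain g where g: "g \<in> path_span G (Greatest Q)" "tclass G n g \<in> S"
      "tclass G n g \<noteq> \<zero>\<^bsub>?A\<^esub>"
      unfolding Q_def by blast
    have g0: "g \<in> path_span G 0" using g(1) path_span_mono[of 0 _ G] by blast
    have "tclass G n f \<otimes>\<^bsub>?A\<^esub> tclass G n g = \<zero>\<^bsub>?A\<^esub>" if "f \<in> path_span G 1" for f
    proof (rule ccontr)
      assume *: "tclass G n f \<otimes>\<^bsub>?A\<^esub> tclass G n g \<noteq> \<zero>\<^bsub>?A\<^esub>"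
      have "tclass G n f \<otimes>\<^bsub>?A\<^esub> tclass G n g \<in> S"
        using g(2) span1[OF that] by (intro S.I_l_closed) auto
      then have "Q (1 + Greatest Q)"
        using * path_mult_path_span[OF that g(1)] unfolding Q_def
        by (auto simp: mult_tclass span1[OF that] g0)
      then show False using greatest by fastforce
    qed
    then have "tclass G n g \<in> S \<inter> N" using g g0 by (auto simp: N_def)
    moreover have "ideal (S \<inter> N) ?A" by (rule A.i_intersect[OF S.is_ideal N])
    ultimately have "S \<inter> N = S"
      using S g(3) unfolding simple_subbimodule_def by blast
    then show ?thesis by blast
  qed
  then have "bimodule_socle ?A \<subseteq> N"
    unfolding bimodule_socle_def by (intro A.genideal_minimal[OF N]) blast
  then show ?thesis using x f by (auto simp: N_def)
qed

text \<open>An arrow into \<open>h\<close> times the trivial path at \<open>h\<close> is that arrow,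
  which has length 1 and so is nonzero in the truncation.\<close>

lemma trivial_path_notin_socle:
  assumes "\<not> is_source G h" "n \<ge> 2"
  shows "pclass G n (h, []) \<notin> bimodule_socle (trunc_algebra G n :: ('k::field, _) module)"
proof
  let ?A = "trunc_algebra G n :: ('k, _) module"
  assume "pclass G n (h, []) \<in> bimodule_socle ?A"
  moreover obtain a where a: "a \<in> arcs G" "head G a = h"
    using assms(1) unfolding is_source_def in_arcs_def by blast
  then have "h \<in> verts G" by auto
  ultimately have "pclass G n (arrow_path G a) = \<zero>\<^bsub>?A\<^esub>"
    using socle_annihilated[of "pclass G n (h, [])" n "Poly_Mapping.single (arrow_path G a) 1"] a
    by (simp add: pclass_eq mult_tclass path_span_single arrow_path_qpath psource_def)
  then have "(1 :: 'k) = 0"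
    using lookup_eqI_tclass[of n "Poly_Mapping.single (arrow_path G a) 1" "0 :: _ \<Rightarrow>\<^sub>0 'k"
        "arrow_path G a"] a assms(2)
    by (simp add: pclass_eq zero_trunc_algebra short_paths_def arrow_path_qpath)
  then show False by simp
qed

section \<open>Spans of path classes\<close>

lemma scalar_mult_trunc_algebra:
  fixes x :: "(_ \<Rightarrow>\<^sub>0 'k::field) set"
  assumes "x \<in> carrier (trunc_algebra G n)"
  shows "(c \<odot>\<^bsub>trunc_algebra G n\<^esub> \<one>\<^bsub>trunc_algebra G n\<^esub>) \<otimes>\<^bsub>trunc_algebra G n\<^esub> x =
    c \<odot>\<^bsub>trunc_algebra G n\<^esub> x"
  using assms
  by (auto simp: carrier_trunc_algebra one_trunc_algebra smult_tclass mult_tclass path_span_scale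
      path_one_in_carrier
      path_mult_scale_left path_mult_one_left)

text \<open>The kernel of a functional is a subspace. Coefficients in \<open>ring.Span\<close> are
  ring elements from \<open>scalars\<close>; \<open>scalar_mult_trunc_algebra\<close> turns them
  into scalar multiples, to which linearity of \<phi> applies.\<close>

lemma Span_subset_carrier_kernel:
  fixes \<phi> :: "_ \<Rightarrow> 'k::field"
  assumes "\<phi> \<in> dual (trunc_algebra G n)" "set us \<subseteq> carrier (trunc_algebra G n)"
    and "\<And>u. u \<in> set us \<Longrightarrow> \<phi> u = 0"
    and "x \<in> ring.Span (trunc_algebra G n) (scalars (trunc_algebra G n)) us"
  shows "x \<in> carrier (trunc_algebra G n) \<and> \<phi> x = 0"
proof -
  let ?A = "trunc_algebra G n :: ('k, _) module"
  interpret A: ring ?A by (rule ring_trunc_algebra)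
  show ?thesis
    using assms(2-4)
  proof (induction us arbitrary: x)
    case Nil
    then show ?case
      using dual_zero_value[OF assms(1)] by (auto simp: zero_trunc_algebra)
  next
    case (Cons u us)
    then obtain c v where v: "v \<in> A.Span (scalars ?A) us"
      and x: "x = (c \<odot>\<^bsub>?A\<^esub> \<one>\<^bsub>?A\<^esub>) \<otimes>\<^bsub>?A\<^esub> u \<oplus>\<^bsub>?A\<^esub> v"
      by (auto simp: A.line_extension_mem_iff scalars_def)
    have v: "v \<in> carrier ?A" "\<phi> v = 0"
      using Cons.IH[OF _ _ v] Cons.prems by auto
    have u: "u \<in> carrier ?A" "\<phi> u = 0" using Cons.prems by auto
    have cu: "c \<odot>\<^bsub>?A\<^esub> u \<in> carrier ?A"
      using u(1) by (auto simp: carrier_trunc_algebra smult_tclass path_span_scale)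
    show ?case
      using u v cu assms(1) unfolding x scalar_mult_trunc_algebra[OF u(1)] dual_def by auto
  qed
qed

text \<open>The coefficients are one at \<open>u\<close> and zero elsewhere, and both lie in
  \<open>scalars\<close>.\<close>

lemma Span_base:
  assumes "set us \<subseteq> carrier (trunc_algebra G n :: ('k::field, _) module)" "u \<in> set us"
  shows "u \<in> ring.Span (trunc_algebra G n) (scalars (trunc_algebra G n)) us"
proof -
  let ?A = "trunc_algebra G n :: ('k, _) module"
  interpret A: ring ?A by (rule ring_trunc_algebra)
  have s: "0 \<odot>\<^bsub>?A\<^esub> x = \<zero>\<^bsub>?A\<^esub>" if "x \<in> carrier ?A" for x
  proof -
    have "Poly_Mapping.map ((*) 0) f = 0" for f :: "('a, 'b) qpath \<Rightarrow>\<^sub>0 'k"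
      by (auto intro!: poly_mapping_eqI)
    then show ?thesis
      using that by (auto simp: carrier_trunc_algebra smult_tclass zero_trunc_algebra)
  qed
  have "\<one>\<^bsub>?A\<^esub> \<in> scalars ?A" "\<zero>\<^bsub>?A\<^esub> \<in> scalars ?A"
    unfolding scalars_def using s[OF A.one_closed] smult_one[OF A.one_closed] by (metis rangeI)+
  note 1 = this
  have zero: "\<zero>\<^bsub>?A\<^esub> \<in> A.Span (scalars ?A) ws" if "set ws \<subseteq> carrier ?A" for ws
    using that
  proof (induction ws)
    case (Cons w ws)
    then show ?case
      using 1 by (auto simp: A.line_extension_mem_iff intro!: bexI[of _ "\<zero>\<^bsub>?A\<^esub>"])
  qed simp
  show ?thesis
    using assms
  proof (induction us)
    case (Cons w ws)
    show ?case
    proof (cases "u = w")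
      case True
      moreover have "w = \<one>\<^bsub>?A\<^esub> \<otimes>\<^bsub>?A\<^esub> w \<oplus>\<^bsub>?A\<^esub> \<zero>\<^bsub>?A\<^esub>"
        using Cons.prems by simp
      moreover have "\<zero>\<^bsub>?A\<^esub> \<in> A.Span (scalars ?A) ws"
        using Cons.prems by (intro zero) simp
      ultimately have "u \<in> A.line_extension (scalars ?A) w (A.Span (scalars ?A) ws)"
        using 1(1) unfolding A.line_extension_mem_iff by blast
      then show ?thesis by simp
    next
      case False
      then have u: "u \<in> A.Span (scalars ?A) ws" "u \<in> carrier ?A" "w \<in> carrier ?A"
        using Cons by auto
      then have "u = \<zero>\<^bsub>?A\<^esub> \<otimes>\<^bsub>?A\<^esub> w \<oplus>\<^bsub>?A\<^esub> u" by simp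
      then have "u \<in> A.line_extension (scalars ?A) w (A.Span (scalars ?A) ws)"
        using 1(2) u(1) unfolding A.line_extension_mem_iff by blast
      then show ?thesis by simp
    qed
  qed simp
qed

text \<open>If \<open>p\<close> were missing, \<open>dual_path G n p\<close> would kill every class
  in the basis, hence the whole socle; but the socle contains the class of \<open>p\<close>, where
  the value is 1.\<close>

lemma maximal_path_in_socle_basis:
  assumes ps: "set ps \<subseteq> qpaths G"
    and basis: "is_basis (trunc_algebra G n :: ('k::field, _) module) (map (pclass G n) ps)
      (bimodule_socle (trunc_algebra G n))"
    and p: "maximal_path n p"
  shows "p \<in> set ps"
proof (rule ccontr)
  let ?A = "trunc_algebra G n :: ('k, _) module"
  assume notin: "p \<notin> set ps"
  have p_short: "p \<in> short_paths G n" and pq: "p \<in> qpaths G"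
    using p by (auto simp: maximal_path_def short_paths_def)
  have span: "pclass G n p \<in> ring.Span ?A (scalars ?A) (map (pclass G n) ps)"
    using basis maximal_path_in_socle[OF p] by (simp add: is_basis_def)
  have kernel: "dual_path G n p u = (0 :: 'k)" if "u \<in> set (map (pclass G n) ps)" for u
    using that ps notin
    by (auto simp: pclass_eq dual_path_tclass path_span_single lookup_single when_def)
  have "set (map (pclass G n) ps) \<subseteq> carrier ?A"
    using ps by auto
  then have "dual_path G n p (pclass G n p) = (0 :: 'k)"
    using Span_subset_carrier_kernel[OF dual_path_in_dual _ kernel span] by blast
  then show False
    using p_short pq by (simp add: pclass_eq dual_path_tclass path_span_single)
qed

lemma trivial_path_notin_socle_basis:
  assumes "set ps \<subseteq> qpaths G"
    and "is_basis (trunc_algebra G n :: ('k::field, _) module) (map (pclass G n) ps)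
      (bimodule_socle (trunc_algebra G n))"
    and "\<not> is_source G h" "n \<ge> 2"
  shows "(h, []) \<notin> set ps"
proof
  let ?A = "trunc_algebra G n :: ('k, _) module"
  assume h: "(h, []) \<in> set ps"
  have "set (map (pclass G n) ps) \<subseteq> carrier ?A"
    using assms(1) by auto
  then have "pclass G n (h, []) \<in> ring.Span ?A (scalars ?A) (map (pclass G n) ps)"
    using h by (intro Span_base) auto
  then have "pclass G n (h, []) \<in> bimodule_socle ?A"
    using assms(2) by (simp add: is_basis_def)
  then show False
    by (rule notE[OF trivial_path_notin_socle[OF assms(3,4)]])
qed

end


section \<open>The extension algebra\<close>

lemma dualI:
  assumes "f \<in> extensional (carrier A)"
    and "\<And>x y. x \<in> carrier A \<Longrightarrow> y \<in> carrier A \<Longrightarrow> f (x \<oplus>\<^bsub>A\<^esub> y) = f x + f y"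
    and "\<And>c x. x \<in> carrier A \<Longrightarrow> f (c \<odot>\<^bsub>A\<^esub> x) = c * f x"
  shows "f \<in> dual A"
  using assms by (simp add: dual_def)

lemma
  assumes "f \<in> dual A"
  shows dual_extensional: "f \<in> extensional (carrier A)"
    and dual_additive: "\<And>x y. x \<in> carrier A \<Longrightarrow> y \<in> carrier A \<Longrightarrow> f (x \<oplus>\<^bsub>A\<^esub> y) = f x + f y"
    and dual_scale: "\<And>c x. x \<in> carrier A \<Longrightarrow> f (c \<odot>\<^bsub>A\<^esub> x) = c * f x"
  using assms by (simp_all add: dual_def)

lemma dual_add_zero_right [simp]: "f \<in> dual A \<Longrightarrow> dual_add A f (dual_zero A) = f"
  by (auto simp: dual_add_def dual_zero_def fun_eq_iff restrict_def dest!: dual_extensional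
      intro: extensional_arb[symmetric])

lemma dual_add_zero_left [simp]: "f \<in> dual A \<Longrightarrow> dual_add A (dual_zero A) f = f"
  by (auto simp: dual_add_def dual_zero_def fun_eq_iff restrict_def dest!: dual_extensional
      intro: extensional_arb[symmetric])

lemma T_alpha_simps:
  "carrier (T_alpha G n xs k) = carrier (trunc_algebra G n) \<times> dual (trunc_algebra G n)"
  "\<zero>\<^bsub>T_alpha G n xs k\<^esub> = (\<zero>\<^bsub>trunc_algebra G n\<^esub>, dual_zero (trunc_algebra G n))"
  "(x, f) \<otimes>\<^bsub>T_alpha G n xs k\<^esub> (y, g) = (x \<otimes>\<^bsub>trunc_algebra G n\<^esub> y,
    dual_add (trunc_algebra G n)
      (dual_add (trunc_algebra G n) (dual_lact (trunc_algebra G n) x g)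
        (dual_ract (trunc_algebra G n) f y))
      (alpha_cocycle G n xs k x y))"
  "(x, f) \<oplus>\<^bsub>T_alpha G n xs k\<^esub> (y, g) =
    (x \<oplus>\<^bsub>trunc_algebra G n\<^esub> y, dual_add (trunc_algebra G n) f g)"
  "c \<odot>\<^bsub>T_alpha G n xs k\<^esub> (x, f) =
    (c \<odot>\<^bsub>trunc_algebra G n\<^esub> x, dual_smult (trunc_algebra G n) c f)"
  by (simp_all add: T_alpha_def cocycle_extension_def)

context fin_digraph
begin

lemma trunc_algebra_closed:
  fixes x y :: "(_ \<Rightarrow>\<^sub>0 'k::field) set"
  assumes "x \<in> carrier (trunc_algebra G n)" "y \<in> carrier (trunc_algebra G n)"
  shows "x \<otimes>\<^bsub>trunc_algebra G n\<^esub> y \<in> carrier (trunc_algebra G n)"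
    and "x \<oplus>\<^bsub>trunc_algebra G n\<^esub> y \<in> carrier (trunc_algebra G n)"
    and "c \<odot>\<^bsub>trunc_algebra G n\<^esub> x \<in> carrier (trunc_algebra G n)"
proof -
  interpret A: ring "trunc_algebra G n :: ('k, _) module" by (rule ring_trunc_algebra)
  show "x \<otimes>\<^bsub>trunc_algebra G n\<^esub> y \<in> carrier (trunc_algebra G n)"
    "x \<oplus>\<^bsub>trunc_algebra G n\<^esub> y \<in> carrier (trunc_algebra G n)"
    using assms by simp_all
  show "c \<odot>\<^bsub>trunc_algebra G n\<^esub> x \<in> carrier (trunc_algebra G n)"
    using assms(1) by (auto simp: carrier_trunc_algebra smult_tclass path_span_scale)
qed

lemma smult_mult_left:
  fixes x y :: "(_ \<Rightarrow>\<^sub>0 'k::field) set"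
  assumes "x \<in> carrier (trunc_algebra G n)" "y \<in> carrier (trunc_algebra G n)"
  shows "(c \<odot>\<^bsub>trunc_algebra G n\<^esub> x) \<otimes>\<^bsub>trunc_algebra G n\<^esub> y =
    c \<odot>\<^bsub>trunc_algebra G n\<^esub> (x \<otimes>\<^bsub>trunc_algebra G n\<^esub> y)"
  using assms
  by (auto simp: carrier_trunc_algebra smult_tclass mult_tclass path_span_scale
      path_mult_scale_left)

lemma smult_mult_right:
  fixes x y :: "(_ \<Rightarrow>\<^sub>0 'k::field) set"
  assumes "x \<in> carrier (trunc_algebra G n)" "y \<in> carrier (trunc_algebra G n)"
  shows "x \<otimes>\<^bsub>trunc_algebra G n\<^esub> (c \<odot>\<^bsub>trunc_algebra G n\<^esub> y) =
    c \<odot>\<^bsub>trunc_algebra G n\<^esub> (x \<otimes>\<^bsub>trunc_algebra G n\<^esub> y)"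
  using assms
  by (auto simp: carrier_trunc_algebra smult_tclass mult_tclass path_span_scale
      path_mult_scale_right)

lemma mult_pclass:
  assumes "p \<in> qpaths G" "q \<in> qpaths G" "ptarget G p = psource q"
  shows "pclass G n p \<otimes>\<^bsub>trunc_algebra G n\<^esub> pclass G n q =
    (pclass G n (pcomp p q) :: (_ \<Rightarrow>\<^sub>0 'k::field) set)"
  using assms by (simp add: pclass_eq mult_tclass path_span_single)

lemma dual_path_pclass:
  assumes "q \<in> qpaths G"
  shows "dual_path G n p (pclass G n q) =
    (if p \<in> short_paths G n \<and> q = p then 1 else (0 :: 'k::field))"
  using assms by (auto simp: pclass_eq dual_path_tclass path_span_single lookup_single when_def)

lemma dual_zero_in_dual [simp]:
  "(dual_zero (trunc_algebra G n) :: _ \<Rightarrow> 'k::field) \<in> dual (trunc_algebra G n)"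
  by (rule dualI) (simp_all add: dual_zero_def trunc_algebra_closed)

lemma dual_add_in_dual:
  fixes f g :: "_ \<Rightarrow> 'k::field"
  assumes "f \<in> dual (trunc_algebra G n)" "g \<in> dual (trunc_algebra G n)"
  shows "dual_add (trunc_algebra G n) f g \<in> dual (trunc_algebra G n)"
  using assms
  by (intro dualI)
    (simp_all add: dual_add_def trunc_algebra_closed dual_additive dual_scale algebra_simps)

lemma dual_lact_in_dual:
  fixes f :: "_ \<Rightarrow> 'k::field"
  assumes "f \<in> dual (trunc_algebra G n)" "x \<in> carrier (trunc_algebra G n)"
  shows "dual_lact (trunc_algebra G n) x f \<in> dual (trunc_algebra G n)"
proof -
  interpret A: ring "trunc_algebra G n :: ('k, _) module" by (rule ring_trunc_algebra)
  show ?thesis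
    using assms
    by (intro dualI) (simp_all add: dual_lact_def trunc_algebra_closed dual_additive dual_scale
        A.l_distr smult_mult_left)
qed

lemma dual_ract_in_dual:
  fixes f :: "_ \<Rightarrow> 'k::field"
  assumes "f \<in> dual (trunc_algebra G n)" "x \<in> carrier (trunc_algebra G n)"
  shows "dual_ract (trunc_algebra G n) f x \<in> dual (trunc_algebra G n)"
proof -
  interpret A: ring "trunc_algebra G n :: ('k, _) module" by (rule ring_trunc_algebra)
  show ?thesis
    using assms
    by (intro dualI) (simp_all add: dual_ract_def trunc_algebra_closed dual_additive dual_scale
        A.r_distr smult_mult_right)
qed

lemma dual_zero_act [simp]:
  fixes x :: "(_ \<Rightarrow>\<^sub>0 'k::field) set"
  assumes "x \<in> carrier (trunc_algebra G n)"
  shows "dual_lact (trunc_algebra G n) x (dual_zero (trunc_algebra G n)) =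
      dual_zero (trunc_algebra G n)"
    and "dual_ract (trunc_algebra G n) (dual_zero (trunc_algebra G n)) x =
      dual_zero (trunc_algebra G n)"
  using assms
  by (auto simp: dual_lact_def dual_ract_def dual_zero_def trunc_algebra_closed fun_eq_iff)

lemma dual_act_zero [simp]:
  fixes f :: "_ \<Rightarrow> 'k::field"
  assumes "f \<in> dual (trunc_algebra G n)"
  shows "dual_lact (trunc_algebra G n) \<zero>\<^bsub>trunc_algebra G n\<^esub> f = dual_zero (trunc_algebra G n)"
    and "dual_ract (trunc_algebra G n) f \<zero>\<^bsub>trunc_algebra G n\<^esub> = dual_zero (trunc_algebra G n)"
proof -
  interpret A: ring "trunc_algebra G n :: ('k, _) module" by (rule ring_trunc_algebra)
  show "dual_lact (trunc_algebra G n) \<zero>\<^bsub>trunc_algebra G n\<^esub> f = dual_zero (trunc_algebra G n)"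
    "dual_ract (trunc_algebra G n) f \<zero>\<^bsub>trunc_algebra G n\<^esub> = dual_zero (trunc_algebra G n)"
    using dual_zero_value[OF assms]
    by (auto simp: dual_lact_def dual_ract_def dual_zero_def fun_eq_iff zero_trunc_algebra
        simp flip: zero_trunc_algebra)
qed

text \<open>The cocycle is built from coordinates, and those of zero vanish. Hence it adds nothing
  to a product whose left factor has component zero in \<open>A\<close>.\<close>

lemma alpha_cocycle_zero_left [simp]:
  fixes k :: "'k::field"
  shows "alpha_cocycle G n xs k \<zero>\<^bsub>trunc_algebra G n\<^esub> y = dual_zero (trunc_algebra G n)"
  by (auto simp: alpha_cocycle_def alpha_component_def dual_zero_def fun_eq_iff
      zero_trunc_algebra dual_path_tclass)

lemma alpha_cocycle_zero_right [simp]: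
  fixes k :: "'k::field"
  shows "alpha_cocycle G n xs k x \<zero>\<^bsub>trunc_algebra G n\<^esub> = dual_zero (trunc_algebra G n)"
  by (auto simp: alpha_cocycle_def alpha_component_def dual_zero_def fun_eq_iff
      zero_trunc_algebra dual_path_tclass)

text \<open>Both nonzero clauses of \<open>alpha_on_paths\<close> need total length at least
  \<open>n\<close>: the first by its condition, the second because the length is then that of the
  whole cycle.\<close>

lemma alpha_cocycle_short:
  fixes k :: "'k::field"
  assumes "p \<in> qpaths G" "q \<in> qpaths G" "plength p + plength q < n" "n \<le> length xs"
  shows "alpha_cocycle G n xs k (pclass G n p) (pclass G n q) = dual_zero (trunc_algebra G n)"
proof -
  have "alpha_on_paths G n xs i p q = (dual_zero (trunc_algebra G n) :: _ \<Rightarrow> 'k)" for i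
  proof -
    have "pcomp p q \<noteq> cycle_segment G xs i (length xs)"
      using assms(3,4) plength_pcomp[of p q] by (auto simp: cycle_segment_def plength_def)
    then show ?thesis
      using assms(3) by (simp add: alpha_on_paths_def Let_def)
  qed
  then have *: "dual_path G n a (pclass G n p) * dual_path G n b (pclass G n q) *
      alpha_on_paths G n xs i a b z = (0 :: 'k)"
    if "z \<in> carrier (trunc_algebra G n)" for a b i z
    using that assms(1,2) by (auto simp: dual_path_pclass dual_zero_def)
  show ?thesis
    unfolding alpha_cocycle_def alpha_component_def dual_zero_def
    by (intro restrict_ext) (simp add: *)
qed

lemma abelian_monoid_T_alpha:
  fixes k :: "'k::field"
  shows "abelian_monoid (T_alpha G n xs k)"
proof -
  interpret A: ring "trunc_algebra G n :: ('k, _) module" by (rule ring_trunc_algebra)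
  show ?thesis
    by (rule abelian_monoidI)
      (auto simp: T_alpha_simps A.a_ac dual_add_in_dual, auto simp: dual_add_def add_ac)
qed

text \<open>\<open>Phi\<close> is a finite sum in \<open>T_alpha\<close>; at a single path with
  coefficient 1 it collapses to \<open>Phi_path\<close>.\<close>

lemma zero_in_T_single_iff:
  fixes k :: "'k::field"
  assumes "Phi_path G n xs k C \<in> carrier (T_alpha G n xs k)"
  shows "zero_in_T G n xs k (Poly_Mapping.single C 1) \<longleftrightarrow>
    Phi_path G n xs k C = (\<zero>\<^bsub>trunc_algebra G n\<^esub>, dual_zero (trunc_algebra G n))"
proof -
  interpret T: abelian_monoid "T_alpha G n xs k" by (rule abelian_monoid_T_alpha)
  have "1 \<odot>\<^bsub>T_alpha G n xs k\<^esub> Phi_path G n xs k C = Phi_path G n xs k C"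
    using assms
    by (cases "Phi_path G n xs k C")
      (auto simp: T_alpha_simps smult_one dual_smult_def fun_eq_iff restrict_def
        dest!: dual_extensional intro: extensional_arb[symmetric])
  then have "Phi G n xs k (Poly_Mapping.single C 1) = Phi_path G n xs k C"
    using assms T.finsum_insert[of "{}" C] by (simp add: Phi_def)
  then show ?thesis by (simp add: zero_in_T_def T_alpha_simps)
qed

section \<open>Products of arrows in the extension\<close>

lemma T_alpha_mult_arrow:
  fixes g :: "_ \<Rightarrow> 'k::field"
  assumes "g \<in> dual (trunc_algebra G n)" "a \<in> arcs G"
  shows "(\<zero>\<^bsub>trunc_algebra G n\<^esub>, g) \<otimes>\<^bsub>T_alpha G n xs k\<^esub> Phi_arrow G n (Inl a) =
    (\<zero>\<^bsub>trunc_algebra G n\<^esub>, dual_ract (trunc_algebra G n) g (pclass G n (arrow_path G a)))"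
proof -
  interpret A: ring "trunc_algebra G n :: ('k, _) module" by (rule ring_trunc_algebra)
  have "pclass G n (arrow_path G a) \<in> carrier (trunc_algebra G n :: ('k, _) module)"
    using assms(2) by (intro pclass_in_carrier arrow_path_qpath)
  then show ?thesis
    using assms(1) by (simp add: Phi_arrow_def T_alpha_simps dual_ract_in_dual)
qed

text \<open>Both factors lie in the copy of \<open>D(A)\<close>, whose square is zero.\<close>

lemma T_alpha_mult_new_arrow:
  fixes g :: "_ \<Rightarrow> 'k::field"
  assumes "g \<in> dual (trunc_algebra G n)"
  shows "(\<zero>\<^bsub>trunc_algebra G n\<^esub>, g) \<otimes>\<^bsub>T_alpha G n xs k\<^esub> Phi_arrow G n (Inr p) =
    (\<zero>\<^bsub>trunc_algebra G n\<^esub>, dual_zero (trunc_algebra G n))"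
proof -
  interpret A: ring "trunc_algebra G n :: ('k, _) module" by (rule ring_trunc_algebra)
  show ?thesis
    using assms by (simp add: Phi_arrow_def T_alpha_simps dual_path_in_dual)
qed

lemma T_alpha_mult_pclass_new_arrow:
  fixes k :: "'k::field"
  assumes "q \<in> qpaths G"
  shows "(pclass G n q, dual_zero (trunc_algebra G n)) \<otimes>\<^bsub>T_alpha G n xs k\<^esub> Phi_arrow G n (Inr p) =
    (\<zero>\<^bsub>trunc_algebra G n\<^esub>, dual_lact (trunc_algebra G n) (pclass G n q) (dual_path G n p))"
proof -
  interpret A: ring "trunc_algebra G n :: ('k, _) module" by (rule ring_trunc_algebra)
  have "pclass G n q \<in> carrier (trunc_algebra G n :: ('k, _) module)"
    using assms by (rule pclass_in_carrier)
  then show ?thesis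
    by (simp add: Phi_arrow_def T_alpha_simps dual_path_in_dual dual_lact_in_dual)
qed

text \<open>The copy of \<open>D(A)\<close> absorbs right factors: after a new arrow has occurred,
  the component in \<open>A\<close> stays zero.\<close>

lemma foldl_zero_fst:
  fixes g :: "_ \<Rightarrow> 'k::field"
  assumes "g \<in> dual (trunc_algebra G n)" "\<And>a. Inl a \<in> set es \<Longrightarrow> a \<in> arcs G"
  shows "\<exists>g'\<in>dual (trunc_algebra G n).
    foldl (\<lambda>t e. t \<otimes>\<^bsub>T_alpha G n xs k\<^esub> Phi_arrow G n e) (\<zero>\<^bsub>trunc_algebra G n\<^esub>, g) es =
      (\<zero>\<^bsub>trunc_algebra G n\<^esub>, g')"
  using assms
proof (induction es arbitrary: g)
  case (Cons e es)
  show ?case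
  proof (cases e)
    case (Inl a)
    then have a: "a \<in> arcs G" using Cons.prems by simp
    then have "pclass G n (arrow_path G a) \<in> carrier (trunc_algebra G n :: ('k, _) module)"
      by (intro pclass_in_carrier arrow_path_qpath)
    then show ?thesis
      using Inl Cons a by (simp add: T_alpha_mult_arrow dual_ract_in_dual)
  next
    case (Inr p)
    then show ?thesis using Cons by (simp add: T_alpha_mult_new_arrow)
  qed
qed auto

text \<open>The first new arrow moves the product into \<open>D(A)\<close>, the arrows of
  \<open>es\<close> keep it there, and the last one kills it.\<close>

lemma two_new_arrows_zero:
  fixes k :: "'k::field"
  assumes "h \<in> verts G" "\<And>a. Inl a \<in> set es \<Longrightarrow> a \<in> arcs G"
  shows "zero_in_T G n xs k (Poly_Mapping.single (h, Inr p # es @ [Inr q]) 1)"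
proof -
  have h: "(h, []) \<in> qpaths G" using assms(1) by simp
  then have "pclass G n (h, []) \<in> carrier (trunc_algebra G n :: ('k, _) module)"
    by (rule pclass_in_carrier)
  then have "dual_lact (trunc_algebra G n) (pclass G n (h, [])) (dual_path G n p)
      \<in> (dual (trunc_algebra G n) :: (_ \<Rightarrow> 'k) set)"
    by (intro dual_lact_in_dual dual_path_in_dual)
  from foldl_zero_fst[OF this assms(2), of es xs k]
  have "Phi_path G n xs k (h, Inr p # es @ [Inr q]) =
      (\<zero>\<^bsub>trunc_algebra G n\<^esub>, dual_zero (trunc_algebra G n))"
    by (auto simp: Phi_path_def T_alpha_mult_pclass_new_arrow[OF h] T_alpha_mult_new_arrow)
  moreover have "\<zero>\<^bsub>trunc_algebra G n\<^esub> \<in> carrier (trunc_algebra G n :: ('k, _) module)"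
    using ring.ring_simprules(2)[OF ring_trunc_algebra] .
  ultimately show ?thesis
    by (subst zero_in_T_single_iff) (simp_all add: T_alpha_simps)
qed

text \<open>For \<open>p\<close> outside the short paths, \<open>dual_path\<close> is the zero
  functional. This disposes of loops coming from an oriented cycle of \<open>G\<close>, which is
  zero in \<open>A\<close>.\<close>

lemma long_new_loop_zero:
  fixes k :: "'k::field"
  assumes "h \<in> verts G" "p \<notin> short_paths G n"
  shows "zero_in_T G n xs k (Poly_Mapping.single (h, [Inr p]) 1)"
proof -
  have h: "(h, []) \<in> qpaths G" using assms(1) by simp
  then have h': "pclass G n (h, []) \<in> carrier (trunc_algebra G n :: ('k, _) module)"
    by (rule pclass_in_carrier)
  have "dual_path G n p = (dual_zero (trunc_algebra G n) :: _ \<Rightarrow> 'k)"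
    using assms(2)
    by (intro dual_eqI[OF dual_path_in_dual dual_zero_in_dual])
      (auto simp: dual_path_pclass short_paths_def dual_zero_def)
  then have "Phi_path G n xs k (h, [Inr p]) =
      (\<zero>\<^bsub>trunc_algebra G n\<^esub>, dual_zero (trunc_algebra G n))"
    using h' by (simp add: Phi_path_def T_alpha_mult_pclass_new_arrow[OF h])
  moreover have "\<zero>\<^bsub>trunc_algebra G n\<^esub> \<in> carrier (trunc_algebra G n :: ('k, _) module)"
    using ring.ring_simprules(2)[OF ring_trunc_algebra] .
  ultimately show ?thesis
    by (subst zero_in_T_single_iff) (simp_all add: T_alpha_simps)
qed

text \<open>Below length \<open>n\<close> the cocycle is silent, so multiplying is concatenating.
  The prefix \<open>ws\<close> is the accumulator of the fold.\<close>

lemma foldl_short_path: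
  fixes k :: "'k::field"
  assumes "(h, ws @ us) \<in> qpaths G" "length (ws @ us) < n" "n \<le> length xs"
  shows "foldl (\<lambda>t e. t \<otimes>\<^bsub>T_alpha G n xs k\<^esub> Phi_arrow G n e)
      (pclass G n (h, ws), dual_zero (trunc_algebra G n)) (map Inl us) =
    (pclass G n (h, ws @ us), dual_zero (trunc_algebra G n))"
  using assms(1,2)
proof (induction us arbitrary: ws)
  case (Cons u us)
  have ws: "(h, ws) \<in> qpaths G" and u: "u \<in> arcs G" "ptarget G (h, ws) = tail G u"
    using Cons.prems by (auto simp: qpath_append qpath_Cons)
  have c: "pclass G n (h, ws) \<in> carrier (trunc_algebra G n :: ('k, _) module)"
    "pclass G n (arrow_path G u) \<in> carrier (trunc_algebra G n :: ('k, _) module)"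
    using ws u by (auto intro: arrow_path_qpath)
  have "alpha_cocycle G n xs k (pclass G n (h, ws)) (pclass G n (arrow_path G u)) =
      dual_zero (trunc_algebra G n)"
    using Cons.prems(2) ws u(1) assms(3)
    by (intro alpha_cocycle_short arrow_path_qpath) (auto simp: plength_def arrow_path_def)
  moreover have "pclass G n (h, ws) \<otimes>\<^bsub>trunc_algebra G n\<^esub> pclass G n (arrow_path G u) =
      (pclass G n (h, ws @ [u]) :: (_ \<Rightarrow>\<^sub>0 'k) set)"
    using ws u mult_pclass[OF ws arrow_path_qpath[OF u(1)]]
    by (simp add: pcomp_def arrow_path_def psource_def)
  ultimately show ?case
    using Cons.IH[of "ws @ [u]"] Cons.prems c by (simp add: Phi_arrow_def T_alpha_simps)
qed simp

text \<open>A right action moves into the argument: \<open>(g v)(y) = g(v y)\<close>. The fold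
  applies the last arrow of \<open>vs\<close> outermost, so the induction strips it from the right
  and prepends it to \<open>ys\<close>, which must therefore vary.\<close>

lemma foldl_dual_value:
  fixes g :: "_ \<Rightarrow> 'k::field"
  assumes "g \<in> dual (trunc_algebra G n)" "(v, vs @ ys) \<in> qpaths G"
  shows "snd (foldl (\<lambda>t e. t \<otimes>\<^bsub>T_alpha G n xs k\<^esub> Phi_arrow G n e) (\<zero>\<^bsub>trunc_algebra G n\<^esub>, g)
      (map Inl vs)) (pclass G n (ptarget G (v, vs), ys)) = g (pclass G n (v, vs @ ys))"
  using assms(2)
proof (induction vs arbitrary: ys rule: rev_induct)
  case (snoc a vs)
  have a: "a \<in> arcs G" "ptarget G (v, vs) = tail G a"
    and ys: "(head G a, ys) \<in> qpaths G" and vs: "(v, vs) \<in> qpaths G"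
    using snoc.prems by (auto simp: qpath_append qpath_Cons)
  have "Inl b \<in> set (map Inl vs) \<Longrightarrow> b \<in> arcs G" for b
    using vs by (auto simp: qpaths_def awalk_def)
  from foldl_zero_fst[OF assms(1) this, of _ xs k]
  obtain g' where g': "g' \<in> dual (trunc_algebra G n)"
    and eq: "foldl (\<lambda>t e. t \<otimes>\<^bsub>T_alpha G n xs k\<^esub> Phi_arrow G n e) (\<zero>\<^bsub>trunc_algebra G n\<^esub>, g)
      (map Inl vs) = (\<zero>\<^bsub>trunc_algebra G n\<^esub>, g')"
    by blast
  have "g' (pclass G n (ptarget G (v, vs), a # ys)) = g (pclass G n (v, vs @ a # ys))"
    using snoc.IH[of "a # ys"] snoc.prems eq by simp
  moreover have "pclass G n (arrow_path G a) \<otimes>\<^bsub>trunc_algebra G n\<^esub> pclass G n (head G a, ys) =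
      (pclass G n (tail G a, a # ys) :: (_ \<Rightarrow>\<^sub>0 'k) set)"
    using mult_pclass[OF arrow_path_qpath[OF a(1)] ys]
    by (simp add: pcomp_def arrow_path_def psource_def)
  moreover have "pclass G n (head G a, ys) \<in> carrier (trunc_algebra G n :: ('k, _) module)"
    using ys by (rule pclass_in_carrier)
  ultimately show ?case
    using a by (simp add: eq T_alpha_mult_arrow[OF g'] dual_ract_def ptarget_append)
qed simp

text \<open>The image has second component \<open>us p^* vs\<close>, where \<open>p\<close> is
  \<open>vs\<close> followed by \<open>us\<close>. Its value at the trivial path at \<open>h\<close>
  is that of \<open>p^*\<close> at \<open>p\<close>, namely 1.\<close>

lemma socle_cycle_nonzero:
  fixes k :: "'k::field"
  assumes p: "(w, vs @ us) \<in> short_paths G n" and h: "h = ptarget G (w, vs)" and "n \<le> length xs"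
  shows "\<not> zero_in_T G n xs k
    (Poly_Mapping.single (h, map Inl us @ Inr (w, vs @ us) # map Inl vs) 1)"
proof -
  let ?A = "trunc_algebra G n :: ('k, _) module"
  let ?p = "(w, vs @ us)"
  let ?C = "(h, map Inl us @ Inr ?p # map Inl vs)"
  have pq: "?p \<in> qpaths G" and len: "length (vs @ us) < n"
    using p by (auto simp: short_paths_def plength_def)
  have vs: "(w, vs) \<in> qpaths G" and us: "(h, us) \<in> qpaths G"
    using pq by (auto simp: qpath_append h)
  have cus: "pclass G n (h, us) \<in> carrier ?A" and cvs: "pclass G n (w, vs) \<in> carrier ?A"
    using vs us by auto
  \<comment> \<open>The functional reached just after the new arrow; the remaining arrows act on it
    from the right.\<close>
  let ?g = "dual_lact ?A (pclass G n (h, us)) (dual_path G n ?p)"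
  have g: "?g \<in> dual ?A"
    using cus by (intro dual_lact_in_dual dual_path_in_dual)
  have "foldl (\<lambda>t e. t \<otimes>\<^bsub>T_alpha G n xs k\<^esub> Phi_arrow G n e)
      (pclass G n (h, []), dual_zero ?A) (map Inl us) = (pclass G n (h, us), dual_zero ?A)"
    using foldl_short_path[of h "[]" us n xs k] us len assms(3) by simp
  then have Phi: "Phi_path G n xs k ?C =
      foldl (\<lambda>t e. t \<otimes>\<^bsub>T_alpha G n xs k\<^esub> Phi_arrow G n e) (\<zero>\<^bsub>?A\<^esub>, ?g) (map Inl vs)"
    by (simp add: Phi_path_def T_alpha_mult_pclass_new_arrow[OF us])
  have "Inl b \<in> set (map Inl vs) \<Longrightarrow> b \<in> arcs G" for b
    using vs by (auto simp: qpaths_def awalk_def)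
  from foldl_zero_fst[OF g this, of _ xs k]
  obtain g' where g': "g' \<in> dual ?A" "Phi_path G n xs k ?C = (\<zero>\<^bsub>?A\<^esub>, g')"
    unfolding Phi by blast
  have "g' (pclass G n (h, [])) = ?g (pclass G n (w, vs))"
    using foldl_dual_value[OF g, of w vs "[]" xs k] vs g'(2)[unfolded Phi] by (simp add: h)
  also have "\<dots> = dual_path G n ?p (pclass G n ?p)"
    using cvs vs us h by (simp add: dual_lact_def mult_pclass pcomp_def psource_def)
  also have "\<dots> = 1"
    using p pq by (simp add: dual_path_pclass)
  finally have "g' (pclass G n (h, [])) = 1" .
  moreover have "pclass G n (h, []) \<in> carrier ?A"
    using us psource_in_verts by (auto simp: psource_def)
  ultimately have "g' \<noteq> dual_zero ?A"
    by (auto simp: dual_zero_def)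
  moreover have "\<zero>\<^bsub>?A\<^esub> \<in> carrier ?A"
    using ring.ring_simprules(2)[OF ring_trunc_algebra] .
  ultimately show ?thesis
    using g' by (subst zero_in_T_single_iff) (simp_all add: T_alpha_simps)
qed

section \<open>Cycles in the extended quiver\<close>

lemma wf_digraph_ext_quiver:
  assumes "M \<subseteq> qpaths G"
  shows "wf_digraph (ext_quiver G M)"
proof
  fix e assume "e \<in> arcs (ext_quiver G M)"
  then show "tail (ext_quiver G M) e \<in> verts (ext_quiver G M)"
    "head (ext_quiver G M) e \<in> verts (ext_quiver G M)"
    using assms by (auto simp: ext_quiver_def psource_in_verts ptarget_in_verts)
qed

lemma ext_quiver_Inl_path:
  assumes "M \<subseteq> qpaths G" "(v, us) \<in> qpaths G"
  shows "(v, map Inl us) \<in> qpaths (ext_quiver G M) \<and>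
    ptarget (ext_quiver G M) (v, map Inl us) = ptarget G (v, us)"
proof -
  interpret E: wf_digraph "ext_quiver G M" by (rule wf_digraph_ext_quiver[OF assms(1)])
  show ?thesis
    using assms(2)
  proof (induction us arbitrary: v)
    case Nil
    then have "v \<in> verts (ext_quiver G M)" by (simp add: ext_quiver_def)
    then show ?case by simp
  next
    case (Cons u us)
    then have "Inl u \<in> arcs (ext_quiver G M)" "tail (ext_quiver G M) (Inl u) = v"
      "head (ext_quiver G M) (Inl u) = head G u" "(head G u, us) \<in> qpaths G"
      by (simp_all add: qpath_Cons ext_quiver_def)
    then show ?case
      using Cons.IH[of "head G u"] by (simp add: E.qpath_Cons)
  qed
qed

text \<open>A path of \<open>M\<close> followed by its new arrow closes up; this is the rotation of
  that cycle which starts at \<open>h\<close>.\<close>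

lemma socle_cycle_at:
  fixes k :: "'k::field"
  assumes "M \<subseteq> qpaths G" and p: "(w, vs @ us) \<in> M" "(w, vs @ us) \<in> short_paths G n"
    and h: "h = ptarget G (w, vs)" and "n \<le> length xs"
  shows "(h, map Inl us @ Inr (w, vs @ us) # map Inl vs) \<in> nonzero_cycles_at G n xs k M h"
proof -
  interpret E: wf_digraph "ext_quiver G M" by (rule wf_digraph_ext_quiver[OF assms(1)])
  have pq: "(w, vs @ us) \<in> qpaths G" using p(1) assms(1) by blast
  have vs: "(w, vs) \<in> qpaths G" and us: "(h, us) \<in> qpaths G"
    using pq by (auto simp: qpath_append h)
  have "tail (ext_quiver G M) (Inr (w, vs @ us)) = ptarget G (h, us)"
    "head (ext_quiver G M) (Inr (w, vs @ us)) = w"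
    "Inr (w, vs @ us) \<in> arcs (ext_quiver G M)"
    using p(1) by (simp_all add: ext_quiver_def ptarget_append h psource_def)
  then have "oriented_cycle (ext_quiver G M) (h, map Inl us @ Inr (w, vs @ us) # map Inl vs)"
    using ext_quiver_Inl_path[OF assms(1) vs] ext_quiver_Inl_path[OF assms(1) us]
    by (simp add: oriented_cycle_def E.qpath_append E.qpath_Cons E.ptarget_append plength_def
        psource_def h)
  then show ?thesis
    using socle_cycle_nonzero[OF p(2) h assms(5)] by (simp add: nonzero_cycles_at_def psource_def)
qed

text \<open>The first arrow leaves \<open>h\<close> and the last one enters it. If neither is old,
  the cycle either has new arrows at two positions or is a single new loop.\<close>

lemma nonzero_cycle_has_old_arrow:
  fixes k :: "'k::field"
  assumes "M \<subseteq> qpaths G" and "(h, []) \<notin> M"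
    and cycles: "\<And>C. oriented_cycle G C \<Longrightarrow>
      pclass G n C = (\<zero>\<^bsub>trunc_algebra G n\<^esub> :: (_ \<Rightarrow>\<^sub>0 'k) set)"
    and C: "C \<in> nonzero_cycles_at G n xs k M h"
  shows "\<exists>a\<in>arcs G. Inl a \<in> set (snd C) \<and> (tail G a = h \<or> head G a = h)"
proof (rule ccontr)
  assume none: "\<not> ?thesis"
  let ?E = "ext_quiver G M"
  interpret E: wf_digraph ?E by (rule wf_digraph_ext_quiver[OF assms(1)])
  obtain es where C_eq: "C = (h, es)"
    using C by (cases C) (simp add: nonzero_cycles_at_def psource_def)
  then have es: "es \<noteq> []" "(h, es) \<in> qpaths ?E" "ptarget ?E (h, es) = h"
    and nz: "\<not> zero_in_T G n xs k (Poly_Mapping.single (h, es) 1)"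
    using C by (auto simp: nonzero_cycles_at_def oriented_cycle_def psource_def plength_def)
  have "h \<in> verts G"
    using E.psource_in_verts[OF es(2)] by (simp add: psource_def ext_quiver_def)
  have old: "a \<in> arcs G" if "Inl a \<in> set es" for a
  proof -
    have "Inl a \<in> arcs ?E"
      using es(2) that by (auto simp: qpaths_def pre_digraph.awalk_def)
    then show ?thesis by (auto simp: ext_quiver_def)
  qed
  obtain e es' where e: "es = e # es'" using es(1) by (cases es) auto
  then have "tail ?E e = h" and e_arc: "e \<in> arcs ?E" and es': "(head ?E e, es') \<in> qpaths ?E"
    using es(2) by (auto simp: E.qpath_Cons)
  then obtain p where p: "e = Inr p"
    using none old e by (cases e) (auto simp: C_eq ext_quiver_def)
  then have pM: "p \<in> M" using e_arc by (auto simp: ext_quiver_def)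
  show False
  proof (cases es' rule: rev_cases)
    case Nil
    then have "head ?E e = h" using es(3) by (simp add: e)
    then have "ptarget G p = h" "psource p = h"
      using \<open>tail ?E e = h\<close> by (simp_all add: p ext_quiver_def)
    moreover have pq: "p \<in> qpaths G" using pM assms(1) by blast
    moreover have "plength p \<noteq> 0"
      using pM assms(2) \<open>psource p = h\<close> by (cases p) (auto simp: plength_def psource_def)
    ultimately have "oriented_cycle G p" by (simp add: oriented_cycle_def)
    \<comment> \<open>The class of the oriented cycle \<open>p\<close> is zero, so its dual
      functional is 0 there; for a short \<open>p\<close> the value would be 1.\<close>
    then have "dual_path G n p (pclass G n p) = (0 :: 'k)"
      using cycles[of p] dual_zero_value[OF dual_path_in_dual, of n p]
      by (simp add: zero_trunc_algebra)
    then have "p \<notin> short_paths G n"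
      using pq by (auto simp: dual_path_pclass)
    from long_new_loop_zero[OF \<open>h \<in> verts G\<close> this]
    have "zero_in_T G n xs k (Poly_Mapping.single (h, es) 1)" by (simp add: e p Nil)
    with nz show False ..
  next
    case (snoc es'' e')
    then have "head ?E e' = h" using es(3) by (simp add: e E.ptarget_append)
    then obtain q where q: "e' = Inr q"
      using none old e snoc by (cases e') (auto simp: C_eq ext_quiver_def)
    then show False
      using two_new_arrows_zero[OF \<open>h \<in> verts G\<close>, of es'' n xs k p q] old nz
      by (simp add: e p snoc)
  qed
qed

text \<open>A short path that is not maximal has length below \<open>n - 1\<close> and an arrow to
  attach at one end. Each attachment lowers \<open>n - length as\<close>, so the process
  stops.\<close>

lemma extends_to_maximal_path:
  assumes "(v, as) \<in> short_paths G n"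
  shows "\<exists>w ls rs. maximal_path n (w, ls @ as @ rs)"
  using assms
proof (induction "n - length as" arbitrary: v as rule: less_induct)
  case less
  then have path: "(v, as) \<in> qpaths G" and len: "length as < n"
    by (auto simp: short_paths_def plength_def)
  show ?case
  proof (cases "maximal_path n (v, as)")
    case True
    then show ?thesis by (intro exI[of _ v] exI[of _ "[]"]) simp
  next
    case False
    then have len': "Suc (length as) < n" and "\<not> is_source G v \<or> \<not> is_sink G (ptarget G (v, as))"
      using less.prems len by (auto simp: maximal_path_def plength_def psource_def)
    then consider a where "a \<in> arcs G" "head G a = v"
      | a where "a \<in> arcs G" "tail G a = ptarget G (v, as)"
      unfolding is_source_def is_sink_def in_arcs_def out_arcs_def by blast
    then show ?thesis
    proof cases
      case 1
      then have "(tail G a, a # as) \<in> short_paths G n"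
        using path len' by (simp add: short_paths_def plength_def qpath_Cons)
      with less.hyps[of "a # as"] len obtain w ls rs
        where "maximal_path n (w, ls @ (a # as) @ rs)"
        by fastforce
      then show ?thesis by (intro exI[of _ w] exI[of _ "ls @ [a]"] exI[of _ rs]) simp
    next
      case 2
      then have "(v, as @ [a]) \<in> short_paths G n"
        using path len' by (simp add: short_paths_def plength_def qpath_append qpath_Cons)
      with less.hyps[of "as @ [a]"] len obtain w ls rs
        where "maximal_path n (w, ls @ (as @ [a]) @ rs)"
        by fastforce
      then show ?thesis by (intro exI[of _ w] exI[of _ ls] exI[of _ "a # rs"]) simp
    qed
  qed
qed

lemma cycle_through_arrows:
  fixes k :: "'k::field"
  assumes ps: "set ps \<subseteq> qpaths G"
    and basis: "is_basis (trunc_algebra G n :: ('k, _) module) (map (pclass G n) ps)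
      (bimodule_socle (trunc_algebra G n))"
    and "3 \<le> n" "n \<le> length xs"
    and ab: "a \<in> arcs G" "head G a = h" "b \<in> arcs G" "tail G b = h"
  shows "\<exists>C\<in>nonzero_cycles_at G n xs k (set ps) h. Inl a \<in> set (snd C) \<and> Inl b \<in> set (snd C)"
proof -
  \<comment> \<open>Here \<open>3 \<le> n\<close> enters: for \<open>n = 2\<close> this path would
    be zero.\<close>
  have "(tail G a, [a, b]) \<in> short_paths G n"
    using ab assms(3) by (simp add: short_paths_def qpath_Cons plength_def)
  then obtain w ls rs where "maximal_path n (w, ls @ [a, b] @ rs)"
    using extends_to_maximal_path by blast
  \<comment> \<open>Regrouped so that the cut between the two factors lies at \<open>h\<close>,
    where the rotated cycle has to start.\<close>
  then have max: "maximal_path n (w, (ls @ [a]) @ (b # rs))" by simp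
  then have short: "(w, (ls @ [a]) @ (b # rs)) \<in> short_paths G n"
    by (simp add: maximal_path_def)
  moreover have "h = ptarget G (w, ls @ [a])"
    using ab by (simp add: ptarget_append)
  ultimately have "(h, map Inl (b # rs) @ Inr (w, (ls @ [a]) @ (b # rs)) # map Inl (ls @ [a]))
      \<in> nonzero_cycles_at G n xs k (set ps) h"
    using maximal_path_in_socle_basis[OF ps basis max] ps assms(4) by (intro socle_cycle_at)
  then show ?thesis by (rule bexI[rotated]) simp
qed

end


text \<open>The generated relation is an intersection, so a pair lies in it once it lies in every
  admissible \<open>E\<close>; hence the quantification over \<open>E\<close>. The full relation on
  \<open>S\<close> is admissible, which bounds the intersection from above.\<close>

lemma card_quotient_generated_equiv:
  assumes "S \<noteq> {}"
    and connected: "\<And>E x y. equiv S E \<Longrightarrow> R \<inter> S \<times> S \<subseteq> E \<Longrightarrow> x \<in> S \<Longrightarrow> y \<in> S \<Longrightarrow> (x, y) \<in> E"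
  shows "card (S // generated_equiv S R) = 1"
proof -
  have "equiv S (S \<times> S)"
    by (auto simp: equiv_def refl_on_def sym_def trans_def)
  then have "generated_equiv S R = S \<times> S"
    unfolding generated_equiv_def using connected by blast
  then have "S // generated_equiv S R = {S}"
    using assms(1) by (auto simp: quotient_def)
  then show ?thesis by simp
qed

theorem corollary4p6:
  fixes G :: "('v, 'a) pre_digraph"
    and n :: nat
    and k :: "'k::alg_closed_field"
    and A :: "('k, (('v, 'a) qpath \<Rightarrow>\<^sub>0 'k) set) module"
    and ps :: "('v, 'a) qpath list"
    and \<gamma> :: "('v, 'a) qpath"
    and h :: 'v
  assumes "fin_digraph G" and "connected G"
    and "n \<ge> 3"
    and "A = trunc_algebra G n"
    and "\<And>C. oriented_cycle G C \<Longrightarrow> pclass G n C = \<zero>\<^bsub>A\<^esub>"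
    and "algebra_dim A > 1"
    and "set ps \<subseteq> qpaths G"
    and "is_basis A (map (pclass G n) ps) (bimodule_socle A)"
    and "oriented_cycle G \<gamma>"
    and "n + 1 \<le> plength \<gamma>" and "plength \<gamma> \<le> 2 * n - 2"
    and "k \<noteq> 0"
    and "h \<in> verts G" and "\<not> is_sink G h" and "\<not> is_source G h"
  shows "card (nonzero_cycles_at G n (snd \<gamma>) k (set ps) h //
               cycle_equiv G n (snd \<gamma>) k (set ps) h) = 1"
proof -
  interpret fin_digraph G by (rule assms(1))
  let ?S = "nonzero_cycles_at G n (snd \<gamma>) k (set ps) h"
  let ?R = "shares_arrow_at (ext_quiver G (set ps)) h"
  have basis: "is_basis (trunc_algebra G n :: ('k, _) module) (map (pclass G n) ps)
      (bimodule_socle (trunc_algebra G n))"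
    using assms(8) by (simp add: assms(4))
  have len: "n \<le> length (snd \<gamma>)" using assms(10) by (simp add: plength_def)
  have through: "\<exists>C\<in>?S. Inl a \<in> set (snd C) \<and> Inl b \<in> set (snd C)"
    if "a \<in> arcs G" "head G a = h" "b \<in> arcs G" "tail G b = h" for a b
    using cycle_through_arrows[OF assms(7) basis assms(3) len that] .
  obtain a0 b0 where a0: "a0 \<in> arcs G" "head G a0 = h" and b0: "b0 \<in> arcs G" "tail G b0 = h"
    using assms(14,15) unfolding is_source_def is_sink_def in_arcs_def out_arcs_def by blast
  have trivial: "(h, []) \<notin> set ps"
    using trivial_path_notin_socle_basis[OF assms(7) basis assms(15)] assms(3) by simp
  show ?thesis
    unfolding cycle_equiv_def
  proof (rule card_quotient_generated_equiv)
    show "?S \<noteq> {}" using through[OF a0 b0] by blast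
  next
    fix E C C'
    assume E: "equiv ?S E" "?R \<inter> ?S \<times> ?S \<subseteq> E" and CC': "C \<in> ?S" "C' \<in> ?S"
    have sym: "(y, x) \<in> E" if "(x, y) \<in> E" for x y
      using E(1) that by (meson equivE symE)
    have trans: "(x, z) \<in> E" if "(x, y) \<in> E" "(y, z) \<in> E" for x y z
      using E(1) that by (meson equivE transE)
    have shared: "(x, y) \<in> E"
      if "x \<in> ?S" "y \<in> ?S" "Inl a \<in> set (snd x)" "Inl a \<in> set (snd y)" "tail G a = h \<or> head G a = h"
      for x y a
      using that E(2) by (force simp: shares_arrow_at_def ext_quiver_def)
    \<comment> \<open>\<open>D\<close> is the hub to which every nonzero cycle at \<open>h\<close>
      is joined.\<close>
    obtain D where D: "D \<in> ?S" "Inl a0 \<in> set (snd D)" "Inl b0 \<in> set (snd D)"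
      using through[OF a0 b0] by blast
    \<comment> \<open>The link is a cycle \<open>Y\<close> sharing the old arrow \<open>a\<close>
      with \<open>B\<close> and \<open>a0\<close> or \<open>b0\<close> with \<open>D\<close>. Which
      one depends on the side of \<open>h\<close> on which \<open>a\<close> lies, since
      \<open>through\<close> needs one arrow into \<open>h\<close> and one out of it.\<close>
    have to_D: "(B, D) \<in> E" if B: "B \<in> ?S" for B
    proof -
      obtain a where a: "a \<in> arcs G" "Inl a \<in> set (snd B)" "tail G a = h \<or> head G a = h"
        using nonzero_cycle_has_old_arrow[OF assms(7) trivial _ B] assms(4,5) by blast
      from a(3) show ?thesis
      proof
        assume "tail G a = h"
        then obtain Y where "Y \<in> ?S" "Inl a0 \<in> set (snd Y)" "Inl a \<in> set (snd Y)"
          using through[OF a0 a(1)] by blast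
        then show ?thesis
          using trans shared[OF B _ a(2) _ a(3)] shared[OF _ D(1) _ D(2)] a0(2) by blast
      next
        assume "head G a = h"
        then obtain Y where "Y \<in> ?S" "Inl a \<in> set (snd Y)" "Inl b0 \<in> set (snd Y)"
          using through[OF a(1) _ b0] by blast
        then show ?thesis
          using trans shared[OF B _ a(2) _ a(3)] shared[OF _ D(1) _ D(3)] b0(2) by blast
      qed
    qed
    show "(C, C') \<in> E"
      using to_D CC' sym trans by blast
  qed
qed

end
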